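(* Let $\boldsymbol\sigma=\{\sigma_i\}_{i=1}^d$ be a shape partition of a nonnegative tensor $\mathcal A\in\mathbb R_+^{N_1\times\cdots\times N_m}$ and let $\mathbf p=(p_1,\ldots,p_d)\in(1,\infty)^d$. Suppose that $\mathcal A$ is $\boldsymbol\sigma$-weakly irreducible and $\sum_{i=1}^d|\sigma_i|/p_i=1$. Let $\bar{\mathbf x}\in\mathbb R^{\boldsymbol\sigma}_{++}$ be the unique positive $(\boldsymbol\sigma,\mathbf p)$-eigenvector of $\mathcal A$ and $\bar{\mathbf y}=\log\bar{\mathbf x}$. Then: (i) The solution set $S_1^*$ of the problem $\min_{\mathbf x\in\mathbb R^{\boldsymbol\sigma}_{++}}\phi(\mathbf x)$ is nonempty and given by $$S_1^*=\{(t^{1/p_1}\bar{\mathbf x}_1,\ldots,t^{1/p_d}\bar{\mathbf x}_d)\in\mathbb R^{\boldsymbol\sigma}_{++}: t\in\mathbb R_{++}\},$$ and the optimal value of this problem is $\phi(\bar{\mathbf x})=r^{(\boldsymbol\sigma,\mathbf p)}(\mathcal A)$. (ii) The solution set $S_2^*$ of the problem $$\min_{(\mathbf y,\mu)\in\mathbb R^{\boldsymbol\sigma}\times\mathbb R}\ \mu\quad\text{s.t.}\quad F(\mathbf y)-\mu\mathbf 1\le 0$$ is nonempty and given by $$S_2^*=\{(\bar{\mathbf y}-\beta(\mathbf p^{[-1]}\otimes\mathbf 1),\ \bar\mu)\in\mathbb R^{\boldsymbol\sigma}\times\mathbb R:\beta\in\mathbb R\},\qquad \bar\mu=\log r^{(\boldsymbol\sigma,\mathbf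 p)}(\mathcal A).$$
   Context: Notation: $[n]=\{1,\ldots,n\}$; $\mathbb R_+$ and $\mathbb R_{++}$ are the nonnegative and positive reals; $\|\cdot\|_p$ is the $\ell_p$-norm; $\mathbf 1$ is the all-ones vector; $\log$, $\exp$, quotients, powers and inequalities of vectors are entrywise; $\mathbf p^{[-1]}=(p_1^{-1},\ldots,p_d^{-1})$; for $\boldsymbol\theta\in\mathbb R^d$ and $\mathbf x=(\mathbf x_1,\ldots,\mathbf x_d)$, $\boldsymbol\theta\otimes\mathbf x=(\theta_1\mathbf x_1,\ldots,\theta_d\mathbf x_d)$. Shape partition: a partition $\boldsymbol\sigma=\{\sigma_i\}_{i=1}^d$ of $[m]$ such that (a) $N_j=N_{j'}$ for all $j,j'\in\sigma_i$ and all $i$; (b) $j\le k$ for all $j\in\sigma_i$, $k\in\sigma_{i+1}$; (c) $|\sigma_i|\le|\sigma_{i+1}|$ for $i\in[d-1]$. Put $\nu_i=|\sigma_i|$, $s_i=\min\sigma_i$, $n_i=N_{s_i}$. Let $\mathbb R^{\boldsymbol\sigma}=\mathbb R^{n_1}\times\cdots\times\mathbb R^{n_d}$, with elements $\mathbf x=(\mathbf x_1,\ldots,\mathbf x_d)$, $\mathbf x_i=(x_{i,1},\ldots,x_{i,n_i})$, and $\mathbb R^{\boldsymbol\sigma}_{+}$, $\mathbb R^{\boldsymbol\sigma}_{++}$ the subsets of entrywise nonnegative, resp. positive, elements. For $\mathbf x\in\mathbb R^{\boldsymbol\sigma}$, $\mathbf x^{[\boldsymbol\sigma]}=(\mathbf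 x_1,\ldots,\mathbf x_1,\ldots,\mathbf x_d,\ldots,\mathbf x_d)$ with $\mathbf x_i$ repeated $\nu_i$ times. For $\mathcal A=(a_{j_1\cdots j_m})$, $i\in[m]$, $j_i\in[N_i]$ and $(\mathbf z_1,\ldots,\mathbf z_m)\in\mathbb R^{N_1}\times\cdots\times\mathbb R^{N_m}$, $\mathscr A_{i,j_i}(\mathbf z_1,\ldots,\mathbf z_m)=\sum_{j_l\in[N_l],\,l\ne i}a_{j_1\cdots j_m}\prod_{l\neq i}z_{l,j_l}$, and $\mathscr A_i=(\mathscr A_{i,1},\ldots,\mathscr A_{i,N_i})$. A pair $(\lambda,\mathbf x)\in\mathbb R\times\mathbb R^{\boldsymbol\sigma}$ is a $(\boldsymbol\sigma,\mathbf p)$-eigenpair of $\mathcal A$ ($\lambda$ an eigenvalue, $\mathbf x$ an eigenvector) if $\mathscr A_{s_i}(\mathbf x^{[\boldsymbol\sigma]})=\lambda\,\psi_{p_i}(\mathbf x_i)$ and $\|\mathbf x_i\|_{p_i}=1$ for all $i\in[d]$, where $\psi_{p}(\mathbf v)$ has entries $|v_j|^{p-1}\mathrm{sign}(v_j)$. The $(\boldsymbol\sigma,\mathbf p)$-spectral radius is $r^{(\boldsymbol\sigma,\mathbf p)}(\mathcal A)=\sup\{|\lambda|:\lambda\text{ is a }(\boldsymbol\sigma,\mathbf p)\text{-eigenvalue of }\mathcal A\}$. Let $M$ be the square matrix of size $n_1+\cdots+n_d$ with $M_{(i,t_i),(j,l_j)}=\frac{\partial}{\partial x_{j,l_j}}\mathscr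 A_{s_i,t_i}(\mathbf x^{[\boldsymbol\sigma]})\big|_{\mathbf x=\mathbf 1}$. The nonnegative tensor $\mathcal A$ is $\boldsymbol\sigma$-weakly irreducible if $M$ is irreducible. By the known Perron–Frobenius theorem of Gautier, Tudisco and Hein, under the hypotheses of the claim $\mathcal A$ has a unique positive $(\boldsymbol\sigma,\mathbf p)$-eigenvector, and its eigenvalue is $r^{(\boldsymbol\sigma,\mathbf p)}(\mathcal A)$. Functions: for $\mathbf x\in\mathbb R^{\boldsymbol\sigma}_{++}$, $\Phi_{i,j_i}(\mathbf x)=\mathscr A_{s_i,j_i}(\mathbf x^{[\boldsymbol\sigma]})/x_{i,j_i}^{p_i-1}$, $\Phi=(\Phi_{i,j_i})_{i\in[d],j_i\in[n_i]}$, $\phi(\mathbf x)=\max_{i\in[d],j_i\in[n_i]}\Phi_{i,j_i}(\mathbf x)$. For $\mathbf y\in\mathbb R^{\boldsymbol\sigma}$, $F(\mathbf y)=\log\Phi(e^{\mathbf y})$ (here $\Phi>0$, so $F$ is well defined). *)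

theory Defs
  imports "HOL-Analysis.Analysis"
begin

text \<open>
  A tensor of order \<open>m\<close> and size \<open>N 1 \<times> \<dots> \<times> N m\<close> is a function \<open>A\<close> of multi-indices
  \<open>j \<in> multi_indices m N\<close>; its values elsewhere play no role. Vectors are
  indexed from 1.
\<close>

definition multi_indices :: "nat \<Rightarrow> (nat \<Rightarrow> nat) \<Rightarrow> (nat \<Rightarrow> nat) set" where
  "multi_indices m N = (\<Pi>\<^sub>E l\<in>{1..m}. {1..N l})"

definition nonneg_tensor :: "nat \<Rightarrow> (nat \<Rightarrow> nat) \<Rightarrow> ((nat \<Rightarrow> nat) \<Rightarrow> real) \<Rightarrow> bool" where
  "nonneg_tensor m N A \<longleftrightarrow> (\<forall>l\<in>{1..m}. 1 \<le> N l) \<and> (\<forall>j\<in>multi_indices m N. 0 \<le> A j)"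

definition shape_partition :: "nat \<Rightarrow> (nat \<Rightarrow> nat) \<Rightarrow> nat \<Rightarrow> (nat \<Rightarrow> nat set) \<Rightarrow> bool" where
  "shape_partition m N d \<sigma> \<longleftrightarrow>
     partition_on {1..m} (\<sigma> ` {1..d}) \<and> inj_on \<sigma> {1..d} \<and>
     (\<forall>i\<in>{1..d}. \<forall>j\<in>\<sigma> i. \<forall>j'\<in>\<sigma> i. N j = N j') \<and>
     (\<forall>i\<in>{1..<d}. \<forall>j\<in>\<sigma> i. \<forall>k\<in>\<sigma> (i + 1). j \<le> k) \<and>
     (\<forall>i\<in>{1..<d}. card (\<sigma> i) \<le> card (\<sigma> (i + 1)))"

definition block_start :: "(nat \<Rightarrow> nat set) \<Rightarrow> nat \<Rightarrow> nat" where
  "block_start \<sigma> i = Min (\<sigma> i)"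

definition block_dim :: "(nat \<Rightarrow> nat) \<Rightarrow> (nat \<Rightarrow> nat set) \<Rightarrow> nat \<Rightarrow> nat" where
  "block_dim N \<sigma> i = N (block_start \<sigma> i)"

text \<open>
  The elements of \<open>\<real>\<^sup>\<sigma>\<close> are extensional functions, so that equality in \<open>\<real>\<^sup>\<sigma>\<close> is equality in HOL;
  \<open>block_vec\<close> builds an element of \<open>\<real>\<^sup>\<sigma>\<close> from its entries.
\<close>

definition block_space :: "(nat \<Rightarrow> nat) \<Rightarrow> nat \<Rightarrow> (nat \<Rightarrow> nat set) \<Rightarrow> (nat \<Rightarrow> nat \<Rightarrow> real) set" where
  "block_space N d \<sigma> = (\<Pi>\<^sub>E i\<in>{1..d}. {1..block_dim N \<sigma> i} \<rightarrow>\<^sub>E UNIV)"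

definition block_space_pos :: "(nat \<Rightarrow> nat) \<Rightarrow> nat \<Rightarrow> (nat \<Rightarrow> nat set) \<Rightarrow> (nat \<Rightarrow> nat \<Rightarrow> real) set" where
  "block_space_pos N d \<sigma> =
     {x \<in> block_space N d \<sigma>. \<forall>i\<in>{1..d}. \<forall>t\<in>{1..block_dim N \<sigma> i}. 0 < x i t}"

definition block_vec ::
    "(nat \<Rightarrow> nat) \<Rightarrow> nat \<Rightarrow> (nat \<Rightarrow> nat set) \<Rightarrow> (nat \<Rightarrow> nat \<Rightarrow> real) \<Rightarrow> nat \<Rightarrow> nat \<Rightarrow> real" where
  "block_vec N d \<sigma> f = (\<lambda>i\<in>{1..d}. \<lambda>t\<in>{1..block_dim N \<sigma> i}. f i t)"

definition block_indices :: "(nat \<Rightarrow> nat) \<Rightarrow> nat \<Rightarrow> (nat \<Rightarrow> nat set) \<Rightarrow> (nat \<times> nat) set" where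
  "block_indices N d \<sigma> = (SIGMA i:{1..d}. {1..block_dim N \<sigma> i})"

definition otimes ::
    "(nat \<Rightarrow> nat) \<Rightarrow> nat \<Rightarrow> (nat \<Rightarrow> nat set) \<Rightarrow> (nat \<Rightarrow> real) \<Rightarrow> (nat \<Rightarrow> nat \<Rightarrow> real) \<Rightarrow> nat \<Rightarrow> nat \<Rightarrow> real" where
  "otimes N d \<sigma> \<theta> x = block_vec N d \<sigma> (\<lambda>i t. \<theta> i * x i t)"

text \<open>
  The \<open>m\<close>-tuple \<open>x\<^bsup>[\<sigma>]\<^esup> = (x\<^sub>1,\<dots>,x\<^sub>1,\<dots>,x\<^sub>d,\<dots>,x\<^sub>d)\<close>, as a function on \<open>{1..m}\<close>.
\<close>

definition block_repeat :: "nat \<Rightarrow> (nat \<Rightarrow> nat set) \<Rightarrow> (nat \<Rightarrow> nat \<Rightarrow> real) \<Rightarrow> nat \<Rightarrow> nat \<Rightarrow> real" where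
  "block_repeat d \<sigma> x l = concat (map (\<lambda>i. replicate (card (\<sigma> i)) (x i)) [1..<d + 1]) ! (l - 1)"

text \<open>\<open>tensor_map m N A i t z\<close> is \<open>\<A>\<^bsub>i,t\<^esub>(z\<^sub>1,\<dots>,z\<^sub>m)\<close>.\<close>

definition tensor_map ::
    "nat \<Rightarrow> (nat \<Rightarrow> nat) \<Rightarrow> ((nat \<Rightarrow> nat) \<Rightarrow> real) \<Rightarrow> nat \<Rightarrow> nat \<Rightarrow> (nat \<Rightarrow> nat \<Rightarrow> real) \<Rightarrow> real" where
  "tensor_map m N A i t z =
     (\<Sum>j\<in>{j \<in> multi_indices m N. j i = t}. A j * (\<Prod>l\<in>{1..m} - {i}. z l (j l)))"

definition lp_norm :: "nat \<Rightarrow> real \<Rightarrow> (nat \<Rightarrow> real) \<Rightarrow> real" where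
  "lp_norm n p v = (\<Sum>t\<in>{1..n}. \<bar>v t\<bar> powr p) powr (1 / p)"

definition psi :: "real \<Rightarrow> (nat \<Rightarrow> real) \<Rightarrow> nat \<Rightarrow> real" where
  "psi p v t = \<bar>v t\<bar> powr (p - 1) * sgn (v t)"

definition eigenpair ::
    "nat \<Rightarrow> (nat \<Rightarrow> nat) \<Rightarrow> nat \<Rightarrow> (nat \<Rightarrow> nat set) \<Rightarrow> (nat \<Rightarrow> real) \<Rightarrow> ((nat \<Rightarrow> nat) \<Rightarrow> real)
     \<Rightarrow> real \<Rightarrow> (nat \<Rightarrow> nat \<Rightarrow> real) \<Rightarrow> bool" where
  "eigenpair m N d \<sigma> p A lam x \<longleftrightarrow>
     x \<in> block_space N d \<sigma> \<and>
     (\<forall>i\<in>{1..d}.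
        (\<forall>t\<in>{1..block_dim N \<sigma> i}.
           tensor_map m N A (block_start \<sigma> i) t (block_repeat d \<sigma> x) = lam * psi (p i) (x i) t) \<and>
        lp_norm (block_dim N \<sigma> i) (p i) (x i) = 1)"

definition eigenvalue ::
    "nat \<Rightarrow> (nat \<Rightarrow> nat) \<Rightarrow> nat \<Rightarrow> (nat \<Rightarrow> nat set) \<Rightarrow> (nat \<Rightarrow> real) \<Rightarrow> ((nat \<Rightarrow> nat) \<Rightarrow> real)
     \<Rightarrow> real \<Rightarrow> bool" where
  "eigenvalue m N d \<sigma> p A lam \<longleftrightarrow> (\<exists>x. eigenpair m N d \<sigma> p A lam x)"

definition positive_eigenvector ::
    "nat \<Rightarrow> (nat \<Rightarrow> nat) \<Rightarrow> nat \<Rightarrow> (nat \<Rightarrow> nat set) \<Rightarrow> (nat \<Rightarrow> real) \<Rightarrow> ((nat \<Rightarrow> nat) \<Rightarrow> real)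
     \<Rightarrow> (nat \<Rightarrow> nat \<Rightarrow> real) \<Rightarrow> bool" where
  "positive_eigenvector m N d \<sigma> p A x \<longleftrightarrow>
     x \<in> block_space_pos N d \<sigma> \<and> (\<exists>lam. eigenpair m N d \<sigma> p A lam x)"

definition tensor_spectral_radius ::
    "nat \<Rightarrow> (nat \<Rightarrow> nat) \<Rightarrow> nat \<Rightarrow> (nat \<Rightarrow> nat set) \<Rightarrow> (nat \<Rightarrow> real) \<Rightarrow> ((nat \<Rightarrow> nat) \<Rightarrow> real)
     \<Rightarrow> real" where
  "tensor_spectral_radius m N d \<sigma> p A = Sup {\<bar>lam\<bar> | lam. eigenvalue m N d \<sigma> p A lam}"

text \<open>
  A square matrix with finite index set \<open>I\<close> is reducible if some simultaneous permutation of rows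
  and columns makes it block triangular with two nonempty diagonal blocks (\<open>S\<close> below is the set of
  row indices of the zero block), or if it is the zero matrix of size one.
\<close>

definition irreducible_matrix :: "'i set \<Rightarrow> ('i \<Rightarrow> 'i \<Rightarrow> real) \<Rightarrow> bool" where
  "irreducible_matrix I M \<longleftrightarrow>
     \<not> (\<exists>S. S \<subseteq> I \<and> S \<noteq> {} \<and> S \<noteq> I \<and> (\<forall>u\<in>S. \<forall>v\<in>I - S. M u v = 0)) \<and>
     \<not> (\<exists>u. I = {u} \<and> M u u = 0)"

text \<open>
  The entry in row \<open>(i,t)\<close> and column \<open>(j,l)\<close> is the partial derivative of \<open>\<A>\<^bsub>s\<^sub>i,t\<^esub>(x\<^bsup>[\<sigma>]\<^esup>)\<close> with
  respect to \<open>x\<^bsub>j,l\<^esub>\<close> at the all-ones vector.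
\<close>

definition jacobian_ones ::
    "nat \<Rightarrow> (nat \<Rightarrow> nat) \<Rightarrow> nat \<Rightarrow> (nat \<Rightarrow> nat set) \<Rightarrow> ((nat \<Rightarrow> nat) \<Rightarrow> real)
     \<Rightarrow> nat \<times> nat \<Rightarrow> nat \<times> nat \<Rightarrow> real" where
  "jacobian_ones m N d \<sigma> A = (\<lambda>(i, t) (j, l).
     deriv (\<lambda>h. tensor_map m N A (block_start \<sigma> i) t
              (block_repeat d \<sigma> (block_vec N d \<sigma> (\<lambda>j' l'. if (j', l') = (j, l) then h else 1)))) 1)"

definition weakly_irreducible ::
    "nat \<Rightarrow> (nat \<Rightarrow> nat) \<Rightarrow> nat \<Rightarrow> (nat \<Rightarrow> nat set) \<Rightarrow> ((nat \<Rightarrow> nat) \<Rightarrow> real) \<Rightarrow> bool" where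
  "weakly_irreducible m N d \<sigma> A \<longleftrightarrow>
     irreducible_matrix (block_indices N d \<sigma>) (jacobian_ones m N d \<sigma> A)"

definition Phi ::
    "nat \<Rightarrow> (nat \<Rightarrow> nat) \<Rightarrow> nat \<Rightarrow> (nat \<Rightarrow> nat set) \<Rightarrow> (nat \<Rightarrow> real) \<Rightarrow> ((nat \<Rightarrow> nat) \<Rightarrow> real)
     \<Rightarrow> (nat \<Rightarrow> nat \<Rightarrow> real) \<Rightarrow> nat \<Rightarrow> nat \<Rightarrow> real" where
  "Phi m N d \<sigma> p A x = block_vec N d \<sigma> (\<lambda>i t.
     tensor_map m N A (block_start \<sigma> i) t (block_repeat d \<sigma> x) / (x i t) powr (p i - 1))"

definition phi_max ::
    "nat \<Rightarrow> (nat \<Rightarrow> nat) \<Rightarrow> nat \<Rightarrow> (nat \<Rightarrow> nat set) \<Rightarrow> (nat \<Rightarrow> real) \<Rightarrow> ((nat \<Rightarrow> nat) \<Rightarrow> real)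
     \<Rightarrow> (nat \<Rightarrow> nat \<Rightarrow> real) \<Rightarrow> real" where
  "phi_max m N d \<sigma> p A x = Max ((\<lambda>(i, t). Phi m N d \<sigma> p A x i t) ` block_indices N d \<sigma>)"

definition F_log ::
    "nat \<Rightarrow> (nat \<Rightarrow> nat) \<Rightarrow> nat \<Rightarrow> (nat \<Rightarrow> nat set) \<Rightarrow> (nat \<Rightarrow> real) \<Rightarrow> ((nat \<Rightarrow> nat) \<Rightarrow> real)
     \<Rightarrow> (nat \<Rightarrow> nat \<Rightarrow> real) \<Rightarrow> nat \<Rightarrow> nat \<Rightarrow> real" where
  "F_log m N d \<sigma> p A y = block_vec N d \<sigma> (\<lambda>i t.
     ln (Phi m N d \<sigma> p A (block_vec N d \<sigma> (\<lambda>i' t'. exp (y i' t'))) i t))"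

definition feasible ::
    "nat \<Rightarrow> (nat \<Rightarrow> nat) \<Rightarrow> nat \<Rightarrow> (nat \<Rightarrow> nat set) \<Rightarrow> (nat \<Rightarrow> real) \<Rightarrow> ((nat \<Rightarrow> nat) \<Rightarrow> real)
     \<Rightarrow> ((nat \<Rightarrow> nat \<Rightarrow> real) \<times> real) set" where
  "feasible m N d \<sigma> p A =
     {(y, mu). y \<in> block_space N d \<sigma> \<and>
        (\<forall>i\<in>{1..d}. \<forall>t\<in>{1..block_dim N \<sigma> i}. F_log m N d \<sigma> p A y i t - mu \<le> 0)}"

definition solution_set :: "('a \<Rightarrow> real) \<Rightarrow> 'a set \<Rightarrow> 'a set" where
  "solution_set f C = {z. is_arg_min f (\<lambda>z. z \<in> C) z}"

end

theory Submission
  imports Defs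
begin

text \<open>
  For positive \<open>x\<close> put \<open>w\<^bsub>i,t\<^esub> = p\<^sub>i ln x\<^bsub>i,t\<^esub>\<close>. The condition \<open>\<Sum>\<^sub>i |\<sigma>\<^sub>i| / p\<^sub>i = 1\<close> makes the exponents
  of each monomial of \<open>\<Phi>\<^bsub>i,t\<^esub>\<close> sum to zero in these coordinates, so that, with \<open>u = (i,t)\<close> and
  \<open>b(l)\<close> the block of the mode \<open>l\<close>,
    \<open>\<Phi>\<^sub>u(x) = \<Sum>\<^sub>j A\<^sub>j exp (\<Sum>\<^sub>l (w\<^bsub>b(l),j\<^sub>l\<^esub> - w\<^sub>u) / p\<^bsub>b(l)\<^esub>)\<close>,
  the sums running over the multi-indices \<open>j\<close> with \<open>j\<^bsub>s\<^sub>i\<^esub> = t\<close> and over the modes \<open>l \<noteq> s\<^sub>i\<close>. Only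
  differences \<open>w\<^sub>v - w\<^sub>u\<close> with positive weights occur. Hence adding a constant to \<open>w\<close>, which is the
  scaling \<open>x\<^sub>i \<mapsto> t\<^bsup>1/p\<^sub>i\<^esup> x\<^sub>i\<close>, changes nothing, and raising \<open>w\<close> at one node does not raise the value
  there and lowers no other value. Weak irreducibility says that from every nonempty proper set of nodes some
  node depends strictly on a node outside the set.

  Three arguments, given for an abstract system of this kind, then prove the theorem.

  \<^item> Existence of a common value. Normalize \<open>w\<close> to have minimum zero. A bound on all values bounds
    the neighbours of every bounded node, hence by irreducibility bounds \<open>w\<close>; so the largest value
    attains its minimum \<open>\<mu>\<close> (\<open>minimum_attained\<close>). A minimizer with the fewest nodes at level \<open>\<mu>\<close>
    has all its nodes there: otherwise, lowering \<open>w\<close> slightly at a node below that level pulls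
    some node off the level (\<open>equalizer_exists\<close>).

  \<^item> Rigidity. If all values at \<open>w\<close> are \<open>\<mu>\<close> and all values at \<open>w'\<close> are at most \<open>\<mu>\<close>, then \<open>w' - w\<close> is
    constant: at a node where \<open>w' - w\<close> is least the value cannot decrease from \<open>w\<close> to \<open>w'\<close>, and it
    increases when a neighbour is not minimal as well (\<open>sublevel_shift\<close>).

  \<^item> Spectral radius. If \<open>z\<close> is any eigenvector, the smallest scaling of the equalizing vector that
    dominates \<open>|z|\<close> touches it at some entry, and comparing the eigenvalue equations at this entry
    bounds the modulus of the eigenvalue by \<open>\<mu>\<close> (\<open>eigenvalue_bound\<close>).

  An equalizing \<open>w\<close>, shifted by a suitable constant, satisfies all norm conditions at once, because
  \<open>\<Sum>\<^sub>t x\<^bsub>i,t\<^esub> \<A>\<^bsub>s\<^sub>i,t\<^esub>(x\<^bsup>[\<sigma>]\<^esup>)\<close> is the full tensor form and so the same for every block \<open>i\<close>. This gives the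
  positive eigenvector and its eigenvalue \<open>\<mu> = r\<close> (\<open>perron_frobenius\<close>). Both minimization problems
  ask for the points where all values are at most \<open>r\<close>, and rigidity describes these.
\<close>

section \<open>Irreducible systems of posynomials in logarithmic coordinates\<close>

lemma continuous_on_Max_finite:
  fixes f :: "'a \<Rightarrow> 'b::topological_space \<Rightarrow> real"
  assumes "finite J" "J \<noteq> {}" "\<And>u. u \<in> J \<Longrightarrow> continuous_on S (f u)"
  shows "continuous_on S (\<lambda>w. Max ((\<lambda>u. f u w) ` J))"
  using assms
proof (induction rule: finite_ne_induct)
  case (insert x F)
  have "continuous_on S (\<lambda>w. max (f x w) (Max ((\<lambda>u. f u w) ` F)))"
    by (intro continuous_on_max) (use insert in auto)
  then show ?case using insert by simp
qed simp

lemma compact_box: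
  fixes B :: real
  shows "compact {w :: 'a \<Rightarrow> real. \<forall>v. w v \<in> (if v \<in> J then {0..B} else {0})}"
proof -
  have "compactin (product_topology (\<lambda>_. euclidean) UNIV)
     (Pi\<^sub>E UNIV (\<lambda>v. (if v \<in> J then {0..B} else {0::real})))"
    by (subst compactin_PiE) auto
  then show ?thesis by (simp add: euclidean_product_topology PiE_def Pi_def)
qed

text \<open>
  The node \<open>u\<close> carries the posynomial \<open>\<Sum>\<^bsub>k\<in>K u\<^esub> a k \<cdot> exp (\<Sum>\<^bsub>l\<in>E u\<^esub> c l \<cdot> (w (g k l) - w u))\<close>. The factor \<open>l\<close>
  of the monomial \<open>k\<close> refers to the node \<open>g k l\<close>, so that a positive coefficient \<open>a k\<close> gives an edge
  from \<open>u\<close> to \<open>g k l\<close>; irreducibility is strong connectedness of the resulting graph.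
\<close>

locale irreducible_posynomials =
  fixes I :: "'i set" and K :: "'i \<Rightarrow> 'k set" and a :: "'k \<Rightarrow> real"
    and E :: "'i \<Rightarrow> 'l set" and c :: "'l \<Rightarrow> real" and g :: "'k \<Rightarrow> 'l \<Rightarrow> 'i"
  assumes finite_I: "finite I" and I_nonempty: "I \<noteq> {}"
    and finite_K: "\<And>u. u \<in> I \<Longrightarrow> finite (K u)"
    and finite_E: "\<And>u. u \<in> I \<Longrightarrow> finite (E u)"
    and coeff_nonneg: "\<And>u k. u \<in> I \<Longrightarrow> k \<in> K u \<Longrightarrow> 0 \<le> a k"
    and weight_pos: "\<And>u l. u \<in> I \<Longrightarrow> l \<in> E u \<Longrightarrow> 0 < c l"
    and node: "\<And>u k l. u \<in> I \<Longrightarrow> k \<in> K u \<Longrightarrow> l \<in> E u \<Longrightarrow> g k l \<in> I"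
    and nonzero: "\<And>u. u \<in> I \<Longrightarrow> \<exists>k\<in>K u. 0 < a k"
    and irreducible: "\<And>S. S \<subseteq> I \<Longrightarrow> S \<noteq> {} \<Longrightarrow> S \<noteq> I \<Longrightarrow>
      \<exists>u\<in>S. \<exists>k\<in>K u. \<exists>l\<in>E u. 0 < a k \<and> g k l \<in> I - S"
begin

definition posy :: "'i \<Rightarrow> ('i \<Rightarrow> real) \<Rightarrow> real" where
  "posy u w = (\<Sum>k\<in>K u. a k * exp (\<Sum>l\<in>E u. c l * (w (g k l) - w u)))"

lemma posy_cong:
  assumes "u \<in> I" "\<And>v. v \<in> I \<Longrightarrow> w v = w' v + s"
  shows "posy u w = posy u w'"
  unfolding posy_def using assms node by (intro sum.cong refl arg_cong2[where f="(*)"] arg_cong[where f=exp]) auto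

lemma posy_pos:
  assumes "u \<in> I"
  shows "0 < posy u w"
proof -
  obtain k where "k \<in> K u" "0 < a k" using nonzero[OF assms] by blast
  then show ?thesis unfolding posy_def
    using assms by (intro sum_pos2[OF finite_K]) (auto intro!: mult_nonneg_nonneg intro: coeff_nonneg)
qed

lemma posy_mono:
  assumes u: "u \<in> I" and le: "\<And>v. v \<in> I \<Longrightarrow> w v - w u \<le> w' v - w' u"
  shows "posy u w \<le> posy u w'"
  unfolding posy_def
  using u by (intro sum_mono mult_left_mono coeff_nonneg)
    (auto intro!: sum_mono mult_left_mono le node less_imp_le[OF weight_pos])

lemma posy_strict_mono:
  assumes u: "u \<in> I" and le: "\<And>v. v \<in> I \<Longrightarrow> w v - w u \<le> w' v - w' u"
    and k: "k \<in> K u" "0 < a k" and l: "l \<in> E u"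
    and less: "w (g k l) - w u < w' (g k l) - w' u"
  shows "posy u w < posy u w'"
proof -
  have *: "(\<Sum>l\<in>E u. c l * (w (g k l) - w u)) < (\<Sum>l\<in>E u. c l * (w' (g k l) - w' u))"
    using u k l less
    by (intro sum_strict_mono_ex1 finite_E)
      (auto intro!: mult_left_mono le node less_imp_le[OF weight_pos] bexI[of _ l] mult_strict_left_mono weight_pos)
  show ?thesis unfolding posy_def
  proof (intro sum_strict_mono_ex1 ballI bexI[of _ k])
    fix k' assume "k' \<in> K u"
    then show "a k' * exp (\<Sum>l\<in>E u. c l * (w (g k' l) - w u))
        \<le> a k' * exp (\<Sum>l\<in>E u. c l * (w' (g k' l) - w' u))"
      using u by (intro mult_left_mono coeff_nonneg)
        (auto intro!: sum_mono mult_left_mono le node less_imp_le[OF weight_pos])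
  qed (use * k u finite_K in auto)
qed

text \<open>
  At a node where \<open>w' - w\<close> is least, every difference \<open>w v - w u\<close> can only grow from \<open>w\<close> to \<open>w'\<close>, and
  monotonicity pushes the value above \<open>\<mu>\<close> as soon as one neighbour lies outside the set of minimizers
  of \<open>w' - w\<close>.
\<close>

lemma sublevel_shift:
  assumes eq: "\<And>u. u \<in> I \<Longrightarrow> posy u w = \<mu>" and le: "\<And>u. u \<in> I \<Longrightarrow> posy u w' \<le> \<mu>"
  shows "\<exists>s. \<forall>v\<in>I. w' v = w v + s"
proof -
  define s where "s = Min ((\<lambda>v. w' v - w v) ` I)"
  have s_le: "s \<le> w' v - w v" if "v \<in> I" for v
    unfolding s_def using that finite_I by auto
  have "s \<in> (\<lambda>v. w' v - w v) ` I" unfolding s_def using finite_I I_nonempty by (intro Min_in) auto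
  define S where "S = {v \<in> I. w' v - w v = s}"
  have S: "S \<subseteq> I" "S \<noteq> {}" using \<open>s \<in> _\<close> by (auto simp: S_def)
  have "S = I"
  proof (rule ccontr)
    assume "S \<noteq> I"
    then obtain u k l where u: "u \<in> S" "k \<in> K u" "l \<in> E u" "0 < a k" "g k l \<in> I - S"
      using irreducible[OF S] by blast
    then have uI: "u \<in> I" and us: "w' u - w u = s" by (auto simp: S_def)
    have "s < w' (g k l) - w (g k l)" using u s_le[of "g k l"] by (auto simp: S_def)
    then have "posy u w < posy u w'" using us
      by (intro posy_strict_mono[OF uI _ u(2,4,3)]) (use s_le in force)+
    then show False using eq[OF uI] le[OF uI] by simp
  qed
  then have "w' v = w v + s" if "v \<in> I" for v using that by (force simp: S_def)
  then show ?thesis by blast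
qed

text \<open>
  The nodes for which a uniform bound exists include \<open>u0\<close>. They are closed under edges: a single
  monomial of \<open>u\<close> is at most \<open>C\<close>, which bounds a positive combination of nonnegative neighbouring
  values in terms of \<open>w u\<close>.
\<close>

lemma sublevel_bounded_at:
  assumes "u0 \<in> I" "v \<in> I"
  shows "\<exists>B. \<forall>w. (\<forall>u\<in>I. posy u w \<le> C \<and> 0 \<le> w u) \<and> w u0 = 0 \<longrightarrow> w v \<le> B"
proof -
  define R where "R = {v \<in> I. \<exists>B. \<forall>w. (\<forall>u\<in>I. posy u w \<le> C \<and> 0 \<le> w u) \<and> w u0 = 0 \<longrightarrow> w v \<le> B}"
  have "u0 \<in> R" using assms(1) by (auto simp: R_def)
  have "R = I"
  proof (rule ccontr)
    assume "R \<noteq> I"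
    moreover have RI: "R \<subseteq> I" by (auto simp: R_def)
    ultimately obtain u k l where u: "u \<in> R" "k \<in> K u" "l \<in> E u" "0 < a k" "g k l \<in> I - R"
      using irreducible[of R] \<open>u0 \<in> R\<close> by blast
    have uI: "u \<in> I" using u RI by auto
    obtain B where B: "\<And>w. (\<forall>u\<in>I. posy u w \<le> C \<and> 0 \<le> w u) \<Longrightarrow> w u0 = 0 \<Longrightarrow> w u \<le> B"
      using u(1) unfolding R_def by blast
    define Q where "Q = sum c (E u)"
    have Q: "0 \<le> Q" unfolding Q_def using uI by (auto intro!: sum_nonneg less_imp_le[OF weight_pos])
    have "w (g k l) \<le> (ln (C / a k) + Q * B) / c l"
      if w: "\<forall>u\<in>I. posy u w \<le> C \<and> 0 \<le> w u" "w u0 = 0" for w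
    proof -
      let ?s = "\<Sum>l\<in>E u. c l * (w (g k l) - w u)"
      have "a k * exp ?s \<le> posy u w" unfolding posy_def
        using u uI by (intro member_le_sum finite_K) (auto intro!: mult_nonneg_nonneg intro: coeff_nonneg)
      also have "\<dots> \<le> C" using w uI by auto
      finally have "exp ?s \<le> C / a k" using u by (simp add: field_simps)
      moreover from this have "0 < C / a k" using exp_gt_zero[of ?s] by linarith
      ultimately have 1: "?s \<le> ln (C / a k)" by (simp add: ln_ge_iff)
      have 2: "?s = (\<Sum>l\<in>E u. c l * w (g k l)) - Q * w u"
        by (simp add: Q_def sum_distrib_right sum_subtractf right_diff_distrib)
      have 3: "c l * w (g k l) \<le> (\<Sum>l\<in>E u. c l * w (g k l))"
        using u uI w node by (intro member_le_sum finite_E) (auto intro!: mult_nonneg_nonneg less_imp_le[OF weight_pos])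
      have "Q * w u \<le> Q * B" using B[OF w] Q by (rule mult_left_mono)
      then have "c l * w (g k l) \<le> ln (C / a k) + Q * B" using 1 2 3 by linarith
      then show ?thesis using weight_pos[OF uI u(3)] by (simp add: field_simps)
    qed
    then have "g k l \<in> R" using u by (auto simp: R_def)
    then show False using u by auto
  qed
  then show ?thesis using assms(2) unfolding R_def by blast
qed

lemma sublevel_bounded:
  obtains B where "0 \<le> B"
    "\<And>w u0 v. \<forall>u\<in>I. posy u w \<le> C \<and> 0 \<le> w u \<Longrightarrow> u0 \<in> I \<Longrightarrow> w u0 = 0 \<Longrightarrow> v \<in> I \<Longrightarrow> w v \<le> B"
proof -
  have "\<forall>p\<in>I\<times>I. \<exists>B. \<forall>w. (\<forall>u\<in>I. posy u w \<le> C \<and> 0 \<le> w u) \<and> w (fst p) = 0 \<longrightarrow> w (snd p) \<le> B"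
    using sublevel_bounded_at by auto
  then obtain b where b: "\<forall>p\<in>I\<times>I. \<forall>w. (\<forall>u\<in>I. posy u w \<le> C \<and> 0 \<le> w u) \<and> w (fst p) = 0 \<longrightarrow> w (snd p) \<le> b p"
    by metis
  show ?thesis
  proof (rule that[of "\<Sum>p\<in>I\<times>I. \<bar>b p\<bar>"])
    fix w u0 v assume w: "\<forall>u\<in>I. posy u w \<le> C \<and> 0 \<le> w u" "u0 \<in> I" "w u0 = 0" "v \<in> I"
    have "w v \<le> b (u0, v)" using b[rule_format, of "(u0, v)" w] w by auto
    then have "w v \<le> \<bar>b (u0, v)\<bar>" by linarith
    also have "\<dots> \<le> (\<Sum>p\<in>I\<times>I. \<bar>b p\<bar>)" using w finite_I by (intro member_le_sum) auto
    finally show "w v \<le> (\<Sum>p\<in>I\<times>I. \<bar>b p\<bar>)" .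
  qed (auto intro: sum_nonneg)
qed

lemma continuous_on_posy: "continuous_on UNIV (\<lambda>w. posy u w)"
  unfolding posy_def by (intro continuous_intros continuous_on_product_coordinates)

text \<open>
  Shift invariance restricts the search to vectors with minimum zero, and for these the sublevel set
  of the value at the zero vector lies in a compact box.
\<close>

lemma minimum_attained:
  obtains w \<mu> where "\<And>u. u \<in> I \<Longrightarrow> posy u w \<le> \<mu>" "\<And>w'. \<exists>u\<in>I. \<mu> \<le> posy u w'"
proof -
  define f where "f w = Max ((\<lambda>u. posy u w) ` I)" for w
  have f_le: "f w \<le> x \<longleftrightarrow> (\<forall>u\<in>I. posy u w \<le> x)" for w x
    unfolding f_def using finite_I I_nonempty by (subst Max_le_iff) auto
  define C where "C = f (\<lambda>_. 0)"
  obtain B where B: "0 \<le> B" "\<And>w u0 v. \<forall>u\<in>I. posy u w \<le> C \<and> 0 \<le> w u \<Longrightarrow> u0 \<in> I \<Longrightarrow> w u0 = 0 \<Longrightarrow> v \<in> I \<Longrightarrow> w v \<le> B"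
    using sublevel_bounded by blast
  define X where "X = {w :: 'i \<Rightarrow> real. \<forall>v. w v \<in> (if v \<in> I then {0..B} else {0})}"
  have 0: "(\<lambda>_. 0) \<in> X" using B by (auto simp: X_def)
  have "continuous_on UNIV f" unfolding f_def
    by (intro continuous_on_Max_finite finite_I I_nonempty continuous_on_posy)
  then have "continuous_on X f" by (rule continuous_on_subset) auto
  moreover have "compact X" unfolding X_def by (rule compact_box)
  ultimately obtain w where w: "w \<in> X" "\<And>w'. w' \<in> X \<Longrightarrow> f w \<le> f w'"
    using continuous_attains_inf[of X f] 0 by blast
  have "f w \<le> f w'" for w'
  proof (cases "f w' \<le> C")
    case True
    define s where "s = Min (w' ` I)"
    have s: "s \<le> w' v" if "v \<in> I" for v unfolding s_def using that finite_I by auto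
    have "s \<in> w' ` I" unfolding s_def using finite_I I_nonempty by auto
    then obtain u0 where u0: "u0 \<in> I" "w' u0 = s" by auto
    \<comment> \<open>The representative of \<open>w'\<close> with minimum zero lies in the box.\<close>
    define z where "z v = (if v \<in> I then w' v - s else 0)" for v
    have Lz: "posy u z = posy u w'" if "u \<in> I" for u
      by (rule posy_cong[OF that, where s="-s"]) (auto simp: z_def)
    have "z v \<le> B" if "v \<in> I" for v
    proof (rule B(2)[OF _ u0(1) _ that])
      show "\<forall>u\<in>I. posy u z \<le> C \<and> 0 \<le> z u" using True Lz s by (simp add: f_le) (simp add: z_def)
    qed (use u0 in \<open>simp add: z_def\<close>)
    then have "z \<in> X" using s by (auto simp: X_def z_def)
    then have "f w \<le> f z" by (rule w)
    also have "f z = f w'" unfolding f_def using Lz by (intro arg_cong[where f=Max] image_cong) auto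
    finally show ?thesis .
  next
    case False
    then show ?thesis using w(2)[OF 0] by (simp add: C_def)
  qed
  then have "\<exists>u\<in>I. f w \<le> posy u w'" for w'
  proof -
    have "f w' \<in> (\<lambda>u. posy u w') ` I" unfolding f_def using finite_I I_nonempty by (intro Max_in) auto
    then show ?thesis using \<open>f w \<le> f w'\<close> by auto
  qed
  moreover have "\<And>u. u \<in> I \<Longrightarrow> posy u w \<le> f w" using f_le by blast
  ultimately show ?thesis using that by blast
qed

text \<open>
  Take, among the minimizers of the largest value \<open>\<mu>\<close>, one with the fewest nodes at this level. If some
  node lies below it, an edge leads from a node at the level to one below; lowering \<open>w\<close> slightly at
  the latter takes the former off the level and lifts no node to it, contradicting minimality.
\<close>

theorem equalizer_exists:
  obtains w \<mu> where "\<And>u. u \<in> I \<Longrightarrow> posy u w = \<mu>"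
proof -
  obtain w0 \<mu> where w0: "\<And>u. u \<in> I \<Longrightarrow> posy u w0 \<le> \<mu>" and low: "\<And>w'. \<exists>u\<in>I. \<mu> \<le> posy u w'"
    by (rule minimum_attained) (rule that)
  define T where "T w = {u \<in> I. posy u w = \<mu>}" for w
  have "\<exists>w. (\<forall>u\<in>I. posy u w \<le> \<mu>) \<and>
      (\<forall>w'. (\<forall>u\<in>I. posy u w' \<le> \<mu>) \<longrightarrow> card (T w) \<le> card (T w'))"
    by (rule ex_has_least_nat[where m = "\<lambda>w. card (T w)" and k = w0]) (use w0 in simp)
  then obtain w where w: "\<forall>u\<in>I. posy u w \<le> \<mu>"
    and min: "\<And>w'. \<forall>u\<in>I. posy u w' \<le> \<mu> \<Longrightarrow> card (T w) \<le> card (T w')"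
    by metis
  have "T w = I"
  proof (rule ccontr)
    assume "T w \<noteq> I"
    moreover have "T w \<subseteq> I" "T w \<noteq> {}" using low[of w] w by (force simp: T_def)+
    ultimately obtain u k l where u: "u \<in> T w" "k \<in> K u" "l \<in> E u" "0 < a k" "g k l \<in> I - T w"
      using irreducible[of "T w"] by blast
    define v where "v = g k l"
    have v: "v \<in> I" "posy v w < \<mu>" "v \<noteq> u" using u w by (auto simp: T_def v_def less_le)
    have uI: "u \<in> I" using u by (auto simp: T_def)
    \<comment> \<open>Lowering \<open>w\<close> at \<open>v\<close> can raise only the value at \<open>v\<close>, which stays below \<open>\<mu>\<close> for small \<open>e\<close>,
        and strictly lowers the value at \<open>u\<close>.\<close>
    define z where "z e = w(v := w v - e)" for e
    have "((\<lambda>e. z e x) \<longlongrightarrow> w x) (at_right 0)" for x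
    proof (cases "x = v")
      case True
      have "((\<lambda>e. w v - e) \<longlongrightarrow> w v - 0) (at_right 0)" by (intro tendsto_intros)
      then show ?thesis using True by (simp add: z_def)
    qed (simp add: z_def)
    then have "((\<lambda>e. posy v (z e)) \<longlongrightarrow> posy v w) (at_right 0)"
      unfolding posy_def by (intro tendsto_intros)
    then have "\<forall>\<^sub>F e in at_right 0. posy v (z e) < \<mu>" using v(2) by (rule order_tendstoD(2))
    then obtain e where e: "0 < e" "posy v (z e) < \<mu>"
      by (metis (mono_tags, lifting) eventually_at_right_field field_lbound_gt_zero)
    have mono: "posy u' (z e) \<le> posy u' w" if "u' \<in> I" "u' \<noteq> v" for u'
      using that e by (intro posy_mono) (auto simp: z_def)
    have strict: "posy u (z e) < posy u w"
      using e v(3) by (intro posy_strict_mono[OF uI _ u(2,4,3)]) (auto simp: z_def v_def)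
    have le: "\<forall>u\<in>I. posy u (z e) \<le> \<mu>"
      using mono w e by (metis less_imp_le order_trans)
    have "T (z e) \<subset> T w"
    proof
      show "T (z e) \<subseteq> T w"
      proof
        fix x assume "x \<in> T (z e)"
        then have x: "x \<in> I" "posy x (z e) = \<mu>" by (auto simp: T_def)
        then have "x \<noteq> v" using e by auto
        then show "x \<in> T w" using mono[of x] w x by (auto simp: T_def intro!: antisym)
      qed
      show "T (z e) \<noteq> T w" 
      proof
        assume "T (z e) = T w"
        then have "posy u (z e) = \<mu>" "posy u w = \<mu>" using u(1) unfolding T_def by auto
        then show False using strict by simp
      qed
    qed
    then have "card (T (z e)) < card (T w)"
      by (intro psubset_card_mono) (auto simp: T_def finite_I)
    then show False using min[OF le] by simp
  qed
  then show ?thesis using that by (auto simp: T_def)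
qed

end

section \<open>Blocks of a shape partition\<close>

text \<open>
  The positions of the repeated entries are counted from one, hence the index \<open>l - 1\<close>.
\<close>

lemma nth_concat_replicate:
  assumes "i \<in> {1..d}" "(\<Sum>k\<in>{1..<i}. f k) < l" "l \<le> (\<Sum>k\<in>{1..i}. f k)"
  shows "concat (map (\<lambda>i. replicate (f i) (x i)) [1..<d + 1]) ! (l - 1) = x i"
  using assms(1)
proof (induction d)
  case (Suc d)
  let ?xs = "concat (map (\<lambda>i. replicate (f i) (x i)) [1..<d + 1])"
  have len: "length ?xs = (\<Sum>k\<in>{1..d}. f k)"
    by (induction d) simp_all
  have split: "concat (map (\<lambda>i. replicate (f i) (x i)) [1..<Suc d + 1]) = ?xs @ replicate (f (Suc d)) (x (Suc d))"
    by simp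
  show ?case
  proof (cases "i = Suc d")
    case True
    then have "(\<Sum>k\<in>{1..d}. f k) < l" "l \<le> (\<Sum>k\<in>{1..d}. f k) + f (Suc d)"
      using assms by (simp_all add: atLeastLessThanSuc_atLeastAtMost)
    then show ?thesis unfolding split nth_append len True by auto
  next
    case False
    then have i: "i \<in> {1..d}" using Suc.prems by auto
    then have "(\<Sum>k\<in>{1..i}. f k) \<le> (\<Sum>k\<in>{1..d}. f k)" by (intro sum_mono2) auto
    then have "l - 1 < length ?xs" using assms len by linarith
    then show ?thesis unfolding split nth_append using Suc.IH[OF i] by simp
  qed
qed simp

lemma initial_segment_eq:
  fixes U :: "nat set"
  assumes "finite U" "U \<subseteq> {1..}" "\<And>a b. a \<in> U \<Longrightarrow> 1 \<le> b \<Longrightarrow> b < a \<Longrightarrow> b \<in> U"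
  shows "U = {1..card U}"
proof (cases "U = {}")
  case False
  have "U = {1..Max U}"
  proof (intro equalityI subsetI)
    fix b assume b: "b \<in> {1..Max U}"
    then show "b \<in> U" using assms(3)[of "Max U" b] Max_in[OF assms(1) False]
      by (cases "b = Max U") auto
  next
    fix b assume "b \<in> U"
    then show "b \<in> {1..Max U}" using assms(1,2) by auto
  qed
  then show ?thesis by (metis card_atLeastAtMost diff_Suc_1)
qed simp

locale partitioned_tensor =
  fixes m d :: nat and N :: "nat \<Rightarrow> nat" and \<sigma> :: "nat \<Rightarrow> nat set"
    and A :: "(nat \<Rightarrow> nat) \<Rightarrow> real" and p :: "nat \<Rightarrow> real"
  assumes nonneg: "nonneg_tensor m N A"
    and shape: "shape_partition m N d \<sigma>"
    and p_gt_1: "\<forall>i\<in>{1..d}. 1 < p i"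
    and weakly_irred: "weakly_irreducible m N d \<sigma> A"
    and exponents: "(\<Sum>i\<in>{1..d}. real (card (\<sigma> i)) / p i) = 1"
begin

abbreviation "s \<equiv> block_start \<sigma>"
abbreviation "n \<equiv> block_dim N \<sigma>"
abbreviation "I \<equiv> block_indices N d \<sigma>"

lemma p_pos: "i \<in> {1..d} \<Longrightarrow> 0 < p i" using p_gt_1 by fastforce

lemma mem_I: "(i, t) \<in> I \<longleftrightarrow> i \<in> {1..d} \<and> t \<in> {1..n i}"
  by (auto simp: block_indices_def)

lemma blocks:
  shows Union_blocks: "(\<Union>i\<in>{1..d}. \<sigma> i) = {1..m}"
    and disjoint_blocks: "i \<in> {1..d} \<Longrightarrow> k \<in> {1..d} \<Longrightarrow> i \<noteq> k \<Longrightarrow> \<sigma> i \<inter> \<sigma> k = {}"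
    and block_nonempty: "i \<in> {1..d} \<Longrightarrow> \<sigma> i \<noteq> {}"
    and block_subset: "i \<in> {1..d} \<Longrightarrow> \<sigma> i \<subseteq> {1..m}"
proof -
  have P: "partition_on {1..m} (\<sigma> ` {1..d})" and inj: "inj_on \<sigma> {1..d}"
    using shape unfolding shape_partition_def by blast+
  show U: "(\<Union>i\<in>{1..d}. \<sigma> i) = {1..m}" using P by (auto simp: partition_on_def)
  show "i \<in> {1..d} \<Longrightarrow> \<sigma> i \<subseteq> {1..m}" using U by blast
  show "i \<in> {1..d} \<Longrightarrow> \<sigma> i \<noteq> {}" using P by (auto simp: partition_on_def)
  assume "i \<in> {1..d}" "k \<in> {1..d}" "i \<noteq> k"
  then have "\<sigma> i \<noteq> \<sigma> k" using inj by (meson inj_on_eq_iff)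
  moreover have "disjoint (\<sigma> ` {1..d})" using P by (simp add: partition_on_def)
  ultimately show "\<sigma> i \<inter> \<sigma> k = {}" using \<open>i \<in> _\<close> \<open>k \<in> _\<close> by (meson disjointD imageI)
qed

lemma finite_block: "i \<in> {1..d} \<Longrightarrow> finite (\<sigma> i)"
  using block_subset finite_subset by blast

lemma consecutive_blocks_ordered:
  assumes "1 \<le> i" "i < d" "a \<in> \<sigma> i" "b \<in> \<sigma> (i + 1)"
  shows "a \<le> b"
proof -
  have "\<forall>i\<in>{1..<d}. \<forall>j\<in>\<sigma> i. \<forall>k\<in>\<sigma> (i + 1). j \<le> k"
    using shape unfolding shape_partition_def by blast
  moreover have "i \<in> {1..<d}" using assms by simp
  ultimately show ?thesis using assms by blast
qed

lemma A_nonneg: "j \<in> multi_indices m N \<Longrightarrow> 0 \<le> A j"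
  and N_pos: "l \<in> {1..m} \<Longrightarrow> 1 \<le> N l"
  using nonneg unfolding nonneg_tensor_def by blast+

lemma blocks_ordered:
  assumes "1 \<le> i" "i < k" "k \<le> d" "a \<in> \<sigma> i" "b \<in> \<sigma> k"
  shows "a \<le> b"
  using assms(2,3,5)
proof (induction k arbitrary: b)
  case (Suc k)
  have step: "\<And>x y. x \<in> \<sigma> k \<Longrightarrow> y \<in> \<sigma> (k + 1) \<Longrightarrow> x \<le> y" if "i \<le> k"
    by (rule consecutive_blocks_ordered[of k]) (use that Suc.prems(2) assms(1) in auto)
  show ?case
  proof (cases "i = k")
    case True
    then show ?thesis using step Suc.prems assms by simp
  next
    case False
    then have "i < k" using Suc.prems by simp
    moreover obtain x where "x \<in> \<sigma> k" using block_nonempty[of k] Suc.prems assms(1) \<open>i < k\<close> by fastforce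
    ultimately show ?thesis using Suc.IH[of x] step[of x b] Suc.prems by simp
  qed
qed simp

text \<open>
  The ordering of the blocks makes the union of the first \<open>i\<close> of them closed downwards in \<open>{1..m}\<close>, so
  that it is determined by its cardinality.
\<close>

lemma Union_blocks_segment:
  assumes "i \<le> d"
  shows "(\<Union>k\<in>{1..i}. \<sigma> k) = {1..(\<Sum>k\<in>{1..i}. card (\<sigma> k))}"
proof -
  let ?U = "\<Union>k\<in>{1..i}. \<sigma> k"
  have sub: "?U \<subseteq> {1..m}" unfolding Union_blocks[symmetric] using assms by (intro UN_mono) auto
  have "?U = {1..card ?U}"
  proof (rule initial_segment_eq)
    show "finite ?U" using sub finite_subset by blast
    show "?U \<subseteq> {1..}" using sub by auto
    fix a b :: nat assume a: "a \<in> ?U" and b: "1 \<le> b" "b < a"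
    obtain k where k: "k \<in> {1..i}" "a \<in> \<sigma> k" using a by blast
    have "a \<in> {1..m}" using sub a by blast
    then have "b \<in> {1..m}" using b by simp
    then obtain k' where k': "k' \<in> {1..d}" "b \<in> \<sigma> k'" using Union_blocks by blast
    have "k' \<le> i"
    proof (rule ccontr)
      assume "\<not> k' \<le> i"
      then have "a \<le> b" using k k' by (intro blocks_ordered[of k k' a b]) auto
      then show False using b by simp
    qed
    then show "b \<in> ?U" using k' by (intro UN_I[of k']) auto
  qed
  moreover have "card ?U = (\<Sum>k\<in>{1..i}. card (\<sigma> k))"
    using assms by (intro card_UN_disjoint ballI impI finite_block disjoint_blocks) auto
  ultimately show ?thesis by metis
qed

definition block :: "nat \<Rightarrow> nat" where
  "block l = (THE i. i \<in> {1..d} \<and> l \<in> \<sigma> i)"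

lemma block_eqI:
  assumes "i \<in> {1..d}" "l \<in> \<sigma> i"
  shows "block l = i"
  unfolding block_def
proof (rule the_equality)
  fix k assume k: "k \<in> {1..d} \<and> l \<in> \<sigma> k"
  show "k = i"
  proof (rule ccontr)
    assume "k \<noteq> i"
    then have "\<sigma> k \<inter> \<sigma> i = {}" using k assms(1) by (intro disjoint_blocks) auto
    then show False using k assms(2) by blast
  qed
qed (use assms in simp)

lemma block_mem:
  assumes "l \<in> {1..m}"
  shows "block l \<in> {1..d} \<and> l \<in> \<sigma> (block l)"
proof -
  obtain i where "i \<in> {1..d}" "l \<in> \<sigma> i" using assms Union_blocks by blast
  then show ?thesis using block_eqI by simp
qed

text \<open>
  The tuple \<open>x\<^bsup>[\<sigma>]\<^esup>\<close> is built by counting block sizes, while the indices of the tensor refer to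
  membership in blocks. The two agree because the blocks are consecutive intervals.
\<close>

lemma block_repeat_eq:
  assumes "l \<in> {1..m}"
  shows "block_repeat d \<sigma> x l = x (block l)"
proof -
  let ?i = "block l"
  have i: "?i \<in> {1..d}" "l \<in> \<sigma> ?i" using block_mem[OF assms] by auto
  have "l \<in> {1..(\<Sum>k\<in>{1..?i}. card (\<sigma> k))}"
  proof -
    have "l \<in> (\<Union>k\<in>{1..?i}. \<sigma> k)" using i by (intro UN_I[of ?i]) auto
    moreover have "?i \<le> d" using i by simp
    ultimately show ?thesis by (simp only: Union_blocks_segment)
  qed
  moreover have "l \<notin> {1..(\<Sum>k\<in>{1..?i - 1}. card (\<sigma> k))}"
  proof
    assume "l \<in> {1..(\<Sum>k\<in>{1..?i - 1}. card (\<sigma> k))}"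
    moreover have "?i - 1 \<le> d" using i(1) diff_le_self[of ?i 1] by (meson atLeastAtMost_iff order_trans)
    ultimately have "l \<in> (\<Union>k\<in>{1..?i - 1}. \<sigma> k)" using Union_blocks_segment[of "?i - 1"] by simp
    then obtain k where "k \<in> {1..?i - 1}" "l \<in> \<sigma> k" by blast
    moreover from this have "block l = k" using i by (intro block_eqI) auto
    ultimately show False using i by auto
  qed
  moreover have "{1..<?i} = {1..?i - 1}" using i by auto
  ultimately show ?thesis unfolding block_repeat_def
    using assms i by (intro nth_concat_replicate) auto
qed

lemma start_mem: "i \<in> {1..d} \<Longrightarrow> s i \<in> \<sigma> i"
  unfolding block_start_def using finite_block block_nonempty by simp

lemma start_in_m: "i \<in> {1..d} \<Longrightarrow> s i \<in> {1..m}"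
  using start_mem block_subset by blast

lemma block_start_eq: "i \<in> {1..d} \<Longrightarrow> block (s i) = i"
  using start_mem block_eqI by blast

lemma N_eq:
  assumes "l \<in> {1..m}"
  shows "N l = n (block l)"
proof -
  have "\<forall>i\<in>{1..d}. \<forall>j\<in>\<sigma> i. \<forall>j'\<in>\<sigma> i. N j = N j'"
    using shape unfolding shape_partition_def by (elim conjE)
  then show ?thesis
    using block_mem[OF assms] start_mem[of "block l"] unfolding block_dim_def by blast
qed

lemma multi_index_node: "j \<in> multi_indices m N \<Longrightarrow> l \<in> {1..m} \<Longrightarrow> (block l, j l) \<in> I"
  using block_mem[of l] N_eq[of l] by (auto simp: mem_I multi_indices_def dest!: PiE_mem)

lemma n_pos: "i \<in> {1..d} \<Longrightarrow> 1 \<le> n i"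
  unfolding block_dim_def by (intro N_pos start_in_m)

lemma d_pos: "1 \<le> d" using exponents by (cases "d = 0") auto

lemma finite_multi_indices: "finite (multi_indices m N)"
  unfolding multi_indices_def by (intro finite_PiE) auto

lemma weights_sum: "(\<Sum>l\<in>{1..m}. 1 / p (block l)) = 1"
proof -
  have "(\<Sum>i\<in>{1..d}. \<Sum>l\<in>{l \<in> {1..m}. block l = i}. 1 / p (block l)) = (\<Sum>l\<in>{1..m}. 1 / p (block l))"
    using block_mem by (intro sum.group) auto
  moreover have "{l \<in> {1..m}. block l = i} = \<sigma> i" if "i \<in> {1..d}" for i
    using that block_mem block_eqI block_subset by blast
  then have "(\<Sum>l\<in>{l \<in> {1..m}. block l = i}. 1 / p (block l)) = real (card (\<sigma> i)) / p i" if "i \<in> {1..d}" for i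
    using that block_eqI by simp
  then have "(\<Sum>i\<in>{1..d}. \<Sum>l\<in>{l \<in> {1..m}. block l = i}. 1 / p (block l)) =
      (\<Sum>i\<in>{1..d}. real (card (\<sigma> i)) / p i)"
    by (rule sum.cong[OF refl])
  ultimately show ?thesis using exponents by linarith
qed

section \<open>The tensor as an irreducible system\<close>

definition rows :: "nat \<times> nat \<Rightarrow> (nat \<Rightarrow> nat) set" where
  "rows u = {j \<in> multi_indices m N. j (s (fst u)) = snd u}"

definition others :: "nat \<times> nat \<Rightarrow> nat set" where
  "others u = {1..m} - {s (fst u)}"

lemma tensor_map_eq:
  "tensor_map m N A (s i) t (block_repeat d \<sigma> x) =
     (\<Sum>j\<in>rows (i, t). A j * (\<Prod>l\<in>others (i, t). x (block l) (j l)))"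
  unfolding tensor_map_def rows_def others_def fst_conv snd_conv
  by (intro sum.cong refl arg_cong2[where f="(*)"] prod.cong) (auto simp: block_repeat_eq)

text \<open>
  If no multi-index with positive coefficient in row \<open>u\<close> involves the variable \<open>v\<close>, the function
  differentiated in the Jacobian entry is constant. This carries irreducibility
  of the Jacobian over to the graph of the system.
\<close>

lemma jacobian_entry_nonzero:
  assumes u: "u \<in> I" and nz: "jacobian_ones m N d \<sigma> A u v \<noteq> 0"
  shows "\<exists>j\<in>rows u. \<exists>l\<in>others u. 0 < A j \<and> (block l, j l) = v"
proof (rule ccontr)
  assume no: "\<not> ?thesis"
  obtain i t where it: "u = (i, t)" by force
  obtain i' t' where it': "v = (i', t')" by force
  have "tensor_map m N A (s i) t (block_repeat d \<sigma> (block_vec N d \<sigma>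
      (\<lambda>j' l'. if (j', l') = (i', t') then h else 1))) = sum A (rows (i, t))" for h
    unfolding tensor_map_eq
  proof (intro sum.cong refl)
    fix j assume j: "j \<in> rows (i, t)"
    show "A j * (\<Prod>l\<in>others (i, t). block_vec N d \<sigma>
      (\<lambda>j' l'. if (j', l') = (i', t') then h else 1) (block l) (j l)) = A j"
    proof (cases "A j = 0")
      case False
      have jm: "j \<in> multi_indices m N" using j by (auto simp: rows_def)
      then have "0 < A j" using False A_nonneg[of j] by simp
      then have "block_vec N d \<sigma> (\<lambda>j' l'. if (j', l') = (i', t') then h else 1) (block l) (j l) = 1"
        if l: "l \<in> others (i, t)" for l
      proof -
        have "(block l, j l) \<noteq> (i', t')" using no j l \<open>0 < A j\<close> unfolding it it' by blast
        moreover have "(block l, j l) \<in> I"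
          using l by (intro multi_index_node jm) (simp add: others_def)
        ultimately show ?thesis by (auto simp: block_vec_def mem_I)
      qed
      then show ?thesis by simp
    qed simp
  qed
  then have "jacobian_ones m N d \<sigma> A u v = 0"
    by (simp add: jacobian_ones_def it it')
  then show False using nz by simp
qed

lemma edge:
  assumes "S \<subseteq> I" "S \<noteq> {}" "S \<noteq> I"
  shows "\<exists>u\<in>S. \<exists>j\<in>rows u. \<exists>l\<in>others u. 0 < A j \<and> (block l, j l) \<in> I - S"
proof -
  obtain u v where "u \<in> S" "v \<in> I - S" "jacobian_ones m N d \<sigma> A u v \<noteq> 0"
    using weakly_irred assms unfolding weakly_irreducible_def irreducible_matrix_def by blast
  then show ?thesis using jacobian_entry_nonzero[of u v] assms(1) by blast
qed

text \<open>
  For a single node there is no proper nonempty set of nodes, and the row is nonzero because the zero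
  matrix of size one counts as reducible.
\<close>

lemma nonzero_row:
  assumes "u \<in> I"
  shows "\<exists>j\<in>rows u. 0 < A j"
proof (cases "I = {u}")
  case True
  then have "jacobian_ones m N d \<sigma> A u u \<noteq> 0"
    using weakly_irred unfolding weakly_irreducible_def irreducible_matrix_def by blast
  then show ?thesis using jacobian_entry_nonzero[OF assms] by blast
next
  case False
  then show ?thesis using edge[of "{u}"] assms by blast
qed

sublocale irreducible_posynomials I rows A others "\<lambda>l. 1 / p (block l)" "\<lambda>j l. (block l, j l)"
proof
  show "finite I" unfolding block_indices_def by (intro finite_SigmaI) auto
  have "(1, 1) \<in> I" using d_pos n_pos[of 1] by (simp add: mem_I)
  then show "I \<noteq> {}" by blast
  show "finite (rows u)" for u using finite_multi_indices by (simp add: rows_def)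
  show "finite (others u)" for u by (simp add: others_def)
  show "0 \<le> A k" if "k \<in> rows u" for u k
    using A_nonneg that by (simp add: rows_def)
  show "0 < 1 / p (block l)" if "l \<in> others u" for u l
    using that block_mem p_pos by (auto simp: others_def)
  show "(block l, k l) \<in> I" if "k \<in> rows u" "l \<in> others u" for u k l
    using that by (auto simp: rows_def others_def intro: multi_index_node)
qed (use nonzero_row edge in auto)

text \<open>
  Dividing by \<open>p i\<close> turns the scalings \<open>x\<^sub>i \<mapsto> t\<^bsup>1/p\<^sub>i\<^esup> x\<^sub>i\<close>, under which the problem is invariant, into
  shifts of \<open>w\<close> by the constant \<open>ln t\<close>.
\<close>

definition point :: "(nat \<times> nat \<Rightarrow> real) \<Rightarrow> nat \<Rightarrow> nat \<Rightarrow> real" where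
  "point w = block_vec N d \<sigma> (\<lambda>i t. exp (w (i, t) / p i))"

definition coords :: "(nat \<Rightarrow> nat \<Rightarrow> real) \<Rightarrow> nat \<times> nat \<Rightarrow> real" where
  "coords x = (\<lambda>(i, t). p i * ln (x i t))"

lemma block_vec_apply: "(i, t) \<in> I \<Longrightarrow> block_vec N d \<sigma> f i t = f i t"
  by (simp add: block_vec_def mem_I)

lemma block_vec_cong:
  assumes "\<And>i t. (i, t) \<in> I \<Longrightarrow> f i t = f' i t"
  shows "block_vec N d \<sigma> f = block_vec N d \<sigma> f'"
  unfolding block_vec_def using assms by (intro restrict_ext) (simp add: mem_I)

lemma block_vec_in_space: "block_vec N d \<sigma> f \<in> block_space N d \<sigma>"
  by (simp add: block_vec_def block_space_def)

lemma block_space_eq_block_vec: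
  assumes "x \<in> block_space N d \<sigma>"
  shows "block_vec N d \<sigma> x = x"
proof
  fix i
  show "block_vec N d \<sigma> x i = x i"
  proof (cases "i \<in> {1..d}")
    case True
    then have "x i \<in> {1..n i} \<rightarrow>\<^sub>E UNIV" using assms unfolding block_space_def by (rule PiE_mem[rotated])
    then show ?thesis using True by (auto simp: block_vec_def PiE_restrict)
  next
    case False
    have "block_vec N d \<sigma> x i = undefined"
      unfolding block_vec_def restrict_def if_not_P[OF False] ..
    then show ?thesis using PiE_arb[OF assms[unfolded block_space_def] False] by simp
  qed
qed

lemma point_apply: "(i, t) \<in> I \<Longrightarrow> point w i t = exp (w (i, t) / p i)"
  by (simp add: point_def block_vec_apply)

lemma point_pos: "point w \<in> block_space_pos N d \<sigma>"
  unfolding block_space_pos_def using block_vec_in_space[of "\<lambda>i t. exp (w (i, t) / p i)"]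
  by (simp add: point_apply mem_I flip: point_def)

lemma point_cong: "(\<And>v. v \<in> I \<Longrightarrow> w v = w' v) \<Longrightarrow> point w = point w'"
  unfolding point_def by (rule block_vec_cong) simp

lemma point_coords:
  assumes "x \<in> block_space_pos N d \<sigma>"
  shows "point (coords x) = x"
proof -
  have "point (coords x) = block_vec N d \<sigma> x"
    unfolding point_def
  proof (rule block_vec_cong)
    fix i t assume "(i, t) \<in> I"
    then have "0 < x i t" "p i \<noteq> 0"
      using assms p_pos[of i] by (auto simp: block_space_pos_def mem_I)
    then show "exp (coords x (i, t) / p i) = x i t" by (simp add: coords_def)
  qed
  then show ?thesis using assms block_space_eq_block_vec by (simp add: block_space_pos_def)
qed

lemma others_weights_sum:
  assumes "i \<in> {1..d}"
  shows "(\<Sum>l\<in>others (i, t). 1 / p (block l)) = 1 - 1 / p i"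
  using weights_sum sum.remove[of "{1..m}" "s i" "\<lambda>l. 1 / p (block l)"] start_in_m[OF assms]
    block_start_eq[OF assms] by (simp add: others_def)

text \<open>
  The exponents of the modes other than \<open>s\<^sub>i\<close> sum to \<open>1 - 1/p\<^sub>i\<close>, so that factoring out that multiple
  of the own coordinate leaves only differences of coordinates in the exponents. The extracted factor
  is exactly \<open>x\<^bsub>i,t\<^esub>\<^bsup>p\<^sub>i - 1\<^esup>\<close>.
\<close>

lemma tensor_map_point:
  assumes "(i, t) \<in> I"
  shows "tensor_map m N A (s i) t (block_repeat d \<sigma> (point w)) = exp (w (i, t) * (1 - 1 / p i)) * posy (i, t) w"
  unfolding tensor_map_eq posy_def sum_distrib_left
proof (rule sum.cong[OF refl])
  fix j assume j: "j \<in> rows (i, t)"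
  let ?u = "(i, t)"
  have "(\<Prod>l\<in>others ?u. point w (block l) (j l)) = (\<Prod>l\<in>others ?u. exp (w (block l, j l) / p (block l)))"
    using node[OF assms j] by (intro prod.cong) (auto simp: point_apply)
  also have "\<dots> = exp (\<Sum>l\<in>others ?u. w (block l, j l) / p (block l))"
    by (rule exp_sum[symmetric]) (simp add: others_def)
  also have "(\<Sum>l\<in>others ?u. w (block l, j l) / p (block l)) =
      (\<Sum>l\<in>others ?u. 1 / p (block l)) * w ?u + (\<Sum>l\<in>others ?u. 1 / p (block l) * (w (block l, j l) - w ?u))"
    by (simp add: sum_distrib_right diff_divide_distrib flip: sum.distrib)
  also have "(\<Sum>l\<in>others ?u. 1 / p (block l)) = 1 - 1 / p i"
    using assms by (intro others_weights_sum) (simp add: mem_I)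
  finally show "A j * (\<Prod>l\<in>others ?u. point w (block l) (j l)) =
      exp (w ?u * (1 - 1 / p i)) * (A j * exp (\<Sum>l\<in>others ?u. 1 / p (block l) * (w (block l, j l) - w ?u)))"
    by (simp add: exp_add mult.commute mult.left_commute)
qed

lemma point_powr:
  assumes "(i, t) \<in> I"
  shows "point w i t powr (p i - 1) = exp (w (i, t) * (1 - 1 / p i))"
proof -
  have "(p i - 1) * (w (i, t) / p i) = w (i, t) * (1 - 1 / p i)"
    using p_pos[of i] assms by (simp add: mem_I field_simps)
  then show ?thesis by (simp add: point_apply[OF assms] powr_def)
qed

lemma Phi_point:
  assumes "(i, t) \<in> I"
  shows "Phi m N d \<sigma> p A (point w) i t = posy (i, t) w"
  unfolding Phi_def block_vec_apply[OF assms] tensor_map_point[OF assms] point_powr[OF assms] by simp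

lemma phi_max_point_le: "phi_max m N d \<sigma> p A (point w) \<le> c \<longleftrightarrow> (\<forall>u\<in>I. posy u w \<le> c)"
proof -
  have "(\<lambda>(i, t). Phi m N d \<sigma> p A (point w) i t) ` I = (\<lambda>u. posy u w) ` I"
    using Phi_point by (intro image_cong refl) (auto split: prod.split)
  then show ?thesis unfolding phi_max_def using finite_I I_nonempty by simp
qed

section \<open>The Perron-Frobenius theorem\<close>

text \<open>
  In logarithmic coordinates \<open>x\<^bsub>i,t\<^esub>\<^bsup>p\<^sub>i\<^esup> = exp w\<^bsub>i,t\<^esub>\<close>, so that the norm conditions do not mention the
  exponents.
\<close>

lemma eigenpair_point_iff:
  "eigenpair m N d \<sigma> p A lam (point w) \<longleftrightarrow>
     (\<forall>u\<in>I. posy u w = lam) \<and> (\<forall>i\<in>{1..d}. (\<Sum>t\<in>{1..n i}. exp (w (i, t))) = 1)"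
proof -
  have eq: "tensor_map m N A (s i) t (block_repeat d \<sigma> (point w)) = lam * psi (p i) (point w i) t \<longleftrightarrow>
      posy (i, t) w = lam" if "(i, t) \<in> I" for i t
    using point_powr[OF that, of w] by (simp add: tensor_map_point that psi_def point_apply)
  have norm: "lp_norm (n i) (p i) (point w i) = 1 \<longleftrightarrow> (\<Sum>t\<in>{1..n i}. exp (w (i, t))) = 1"
    if i: "i \<in> {1..d}" for i
  proof -
    have "(\<Sum>t\<in>{1..n i}. \<bar>point w i t\<bar> powr p i) = (\<Sum>t\<in>{1..n i}. exp (w (i, t)))"
      using i p_pos[OF i] by (intro sum.cong) (auto simp: mem_I point_apply powr_def)
    moreover have "0 < (\<Sum>t\<in>{1..n i}. exp (w (i, t)))"
      using n_pos[OF i] by (intro sum_pos) auto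
    ultimately show ?thesis using p_pos[OF i] unfolding lp_norm_def by (simp add: powr_def)
  qed
  have "eigenpair m N d \<sigma> p A lam (point w) \<longleftrightarrow>
     (\<forall>i\<in>{1..d}. (\<forall>t\<in>{1..n i}. posy (i, t) w = lam) \<and> (\<Sum>t\<in>{1..n i}. exp (w (i, t))) = 1)"
    unfolding eigenpair_def using point_pos[of w] eq norm by (simp add: block_space_pos_def mem_I)
  then show ?thesis by (auto simp: block_indices_def)
qed

text \<open>
  Contracting the remaining mode \<open>s\<^sub>i\<close> with \<open>x\<^sub>i\<close> yields the full multilinear form, whichever block was
  chosen.
\<close>

lemma tensor_form_eq:
  assumes i: "i \<in> {1..d}"
  shows "(\<Sum>t\<in>{1..n i}. x i t * tensor_map m N A (s i) t (block_repeat d \<sigma> x)) =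
    (\<Sum>j\<in>multi_indices m N. A j * (\<Prod>l\<in>{1..m}. x (block l) (j l)))"
proof -
  let ?f = "\<lambda>j. A j * (\<Prod>l\<in>{1..m}. x (block l) (j l))"
  have "(\<Sum>t\<in>{1..n i}. x i t * tensor_map m N A (s i) t (block_repeat d \<sigma> x)) =
      (\<Sum>t\<in>{1..n i}. \<Sum>j\<in>{j \<in> multi_indices m N. j (s i) = t}. ?f j)"
    unfolding tensor_map_eq sum_distrib_left
  proof (intro sum.cong)
    fix t j assume "j \<in> {j \<in> multi_indices m N. j (s i) = t}"
    then have "(\<Prod>l\<in>{1..m}. x (block l) (j l)) = x i t * (\<Prod>l\<in>others (i, t). x (block l) (j l))"
      using prod.remove[of "{1..m}" "s i" "\<lambda>l. x (block l) (j l)"] start_in_m[OF i] block_start_eq[OF i]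
      by (simp add: others_def)
    then show "x i t * (A j * (\<Prod>l\<in>others (i, t). x (block l) (j l))) = ?f j" by simp
  qed (simp_all add: rows_def)
  also have "\<dots> = (\<Sum>j\<in>multi_indices m N. ?f j)"
  proof (rule sum.group)
    show "(\<lambda>j. j (s i)) ` multi_indices m N \<subseteq> {1..n i}"
      using multi_index_node[OF _ start_in_m[OF i]] block_start_eq[OF i] by (auto simp: mem_I)
  qed (use finite_multi_indices in auto)
  finally show ?thesis .
qed

text \<open>
  At an equalizer the sum of \<open>x\<^bsub>i,t\<^esub>\<^bsup>p\<^sub>i\<^esup>\<close> over the block \<open>i\<close> is the tensor form divided by \<open>\<mu>\<close>, hence the
  same for all blocks, and one shift normalizes all of them.
\<close>

lemma normalized_equalizer_exists:
  "\<exists>w \<mu>. (\<forall>u\<in>I. posy u w = \<mu>) \<and> eigenpair m N d \<sigma> p A \<mu> (point w) \<and> 0 < \<mu>"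
proof -
  obtain w0 \<mu> where w0: "\<And>u. u \<in> I \<Longrightarrow> posy u w0 = \<mu>" by (rule equalizer_exists) (rule that)
  have \<mu>: "0 < \<mu>" using I_nonempty w0 posy_pos by (metis ex_in_conv)
  let ?S = "\<lambda>i. \<Sum>t\<in>{1..n i}. exp (w0 (i, t))"
  let ?T = "\<Sum>j\<in>multi_indices m N. A j * (\<Prod>l\<in>{1..m}. point w0 (block l) (j l))"
  have S: "?S i = ?T / \<mu>" if i: "i \<in> {1..d}" for i
  proof -
    have "?T = (\<Sum>t\<in>{1..n i}. point w0 i t * tensor_map m N A (s i) t (block_repeat d \<sigma> (point w0)))"
      using tensor_form_eq[OF i, of "point w0"] by simp
    also have "\<dots> = (\<Sum>t\<in>{1..n i}. exp (w0 (i, t)) * \<mu>)"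
    proof (intro sum.cong refl)
      fix t assume "t \<in> {1..n i}"
      then have u: "(i, t) \<in> I" using i by (simp add: mem_I)
      have "exp (w0 (i, t) / p i) * exp (w0 (i, t) * (1 - 1 / p i)) = exp (w0 (i, t))"
        by (simp add: right_diff_distrib flip: exp_add)
      then show "point w0 i t * tensor_map m N A (s i) t (block_repeat d \<sigma> (point w0)) = exp (w0 (i, t)) * \<mu>"
        by (simp add: point_apply[OF u] tensor_map_point[OF u] w0[OF u] flip: mult.assoc)
    qed
    finally have "?T = ?S i * \<mu>" by (simp only: sum_distrib_right)
    then show ?thesis using \<mu> by (metis less_irrefl nonzero_mult_div_cancel_right)
  qed
  have 1: "1 \<in> {1..d}" using d_pos by simp
  have "{1..n 1} \<noteq> {}" using n_pos[OF 1] by simp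
  then have "0 < ?S 1" by (intro sum_pos) auto
  then have T: "0 < ?T / \<mu>" unfolding S[OF 1] .
  define w where "w v = w0 v - ln (?T / \<mu>)" for v
  have Lw: "posy u w = \<mu>" if "u \<in> I" for u
    using w0[OF that] posy_cong[OF that, of w w0 "- ln (?T / \<mu>)"] by (simp add: w_def)
  moreover have "(\<Sum>t\<in>{1..n i}. exp (w (i, t))) = 1" if "i \<in> {1..d}" for i
  proof -
    have "(\<Sum>t\<in>{1..n i}. exp (w (i, t))) = ?S i / (?T / \<mu>)"
      unfolding w_def exp_diff exp_ln[OF T] by (rule sum_divide_distrib[symmetric])
    also have "\<dots> = 1" unfolding S[OF that] using T by (intro divide_self) (rule less_imp_neq[symmetric])
    finally show ?thesis .
  qed
  ultimately have "eigenpair m N d \<sigma> p A \<mu> (point w)" by (simp add: eigenpair_point_iff)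
  then show ?thesis using Lw \<mu> by (intro exI[of _ w] exI[of _ \<mu>]) simp
qed

text \<open>
  Rigidity applies to whichever of the two eigenvectors has the larger eigenvalue; the norm condition
  on a single block then fixes the scaling.
\<close>

lemma positive_eigenvector_unique:
  assumes w: "\<And>u. u \<in> I \<Longrightarrow> posy u w = \<mu>" "eigenpair m N d \<sigma> p A \<mu> (point w)"
    and x: "positive_eigenvector m N d \<sigma> p A x"
  shows "x = point w"
proof -
  define w' where "w' = coords x"
  have xw: "x = point w'" using x point_coords by (simp add: w'_def positive_eigenvector_def)
  obtain \<mu>' where e: "eigenpair m N d \<sigma> p A \<mu>' (point w')"
    using x unfolding positive_eigenvector_def xw by blast
  then have w': "\<And>u. u \<in> I \<Longrightarrow> posy u w' = \<mu>'" by (simp add: eigenpair_point_iff)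
  have "\<exists>s. \<forall>v\<in>I. w' v = w v + s"
  proof (cases "\<mu>' \<le> \<mu>")
    case True
    then show ?thesis using w w' by (intro sublevel_shift[where \<mu>=\<mu>]) auto
  next
    case False
    then have "\<exists>s. \<forall>v\<in>I. w v = w' v + s" using w w' by (intro sublevel_shift[where \<mu>=\<mu>']) auto
    then obtain r where "\<forall>v\<in>I. w v = w' v + r" ..
    then show ?thesis by (intro exI[of _ "-r"]) simp
  qed
  then obtain r where r: "\<And>v. v \<in> I \<Longrightarrow> w' v = w v + r" by blast
  have 1: "1 \<in> {1..d}" using d_pos by simp
  have "(\<Sum>t\<in>{1..n 1}. exp (w' (1, t))) = (\<Sum>t\<in>{1..n 1}. exp (w (1, t)) * exp r)"
    using r 1 by (intro sum.cong refl) (simp add: mem_I exp_add)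
  also have "\<dots> = (\<Sum>t\<in>{1..n 1}. exp (w (1, t))) * exp r" by (rule sum_distrib_right[symmetric])
  finally have "exp r = 1" using e w(2) 1 by (simp add: eigenpair_point_iff)
  then show ?thesis unfolding xw using r by (intro point_cong) simp
qed

text \<open>
  The vector \<open>x\<close> below is the least scaling of \<open>point w\<close> that dominates \<open>|z|\<close> entrywise; the bound is
  read off at an entry where the two are equal.
\<close>

lemma eigenvalue_bound:
  assumes w: "\<And>u. u \<in> I \<Longrightarrow> posy u w = \<mu>" and z: "eigenpair m N d \<sigma> p A lam z"
  shows "\<bar>lam\<bar> \<le> \<mu>"
proof -
  \<comment> \<open>Entries with \<open>z i t = 0\<close> are left out because \<open>ln 0 = 0\<close> would distort the maximum.\<close>
  define Z where "Z = {(i, t) \<in> I. z i t \<noteq> 0}"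
  define \<delta> where "\<delta> = (\<lambda>(i, t). p i * ln \<bar>z i t\<bar> - w (i, t))"
  have fin: "finite Z" unfolding Z_def using finite_I by (rule rev_finite_subset) blast
  have "Z \<noteq> {}"
  proof
    assume "Z = {}"
    then have "z 1 t = 0" if "t \<in> {1..n 1}" for t using that d_pos by (auto simp: Z_def mem_I)
    then have "lp_norm (n 1) (p 1) (z 1) = 0" by (simp add: lp_norm_def)
    moreover have "lp_norm (n 1) (p 1) (z 1) = 1" using z d_pos by (simp add: eigenpair_def)
    ultimately show False by simp
  qed
  define M where "M = Max (\<delta> ` Z)"
  have le_M: "\<delta> v \<le> M" if "v \<in> Z" for v unfolding M_def using that fin by simp
  have "M \<in> \<delta> ` Z" unfolding M_def using fin \<open>Z \<noteq> {}\<close> by (intro Max_in) auto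
  then obtain i t where it: "(i, t) \<in> Z" "M = \<delta> (i, t)" by auto
  have u: "(i, t) \<in> I" using it by (simp add: Z_def)
  define x where "x = point (\<lambda>v. w v + M)"
  have dominated: "\<bar>z i' t'\<bar> \<le> x i' t'" if v: "(i', t') \<in> I" for i' t'
  proof (cases "z i' t' = 0")
    case False
    then have "p i' * ln \<bar>z i' t'\<bar> \<le> w (i', t') + M"
      using le_M[of "(i', t')"] v by (simp add: Z_def \<delta>_def)
    then have "ln \<bar>z i' t'\<bar> \<le> (w (i', t') + M) / p i'"
      using p_pos[of i'] v by (simp add: mem_I field_simps)
    then show ?thesis using False unfolding x_def point_apply[OF v]
      by (metis exp_le_cancel_iff exp_ln zero_less_abs_iff)
  qed (simp add: x_def point_apply[OF v])
  have attained: "\<bar>z i t\<bar> = x i t"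
    using it u p_pos[of i] by (simp add: x_def point_apply[OF u] Z_def \<delta>_def mem_I)
  have "\<bar>lam\<bar> * \<bar>z i t\<bar> powr (p i - 1) = \<bar>tensor_map m N A (s i) t (block_repeat d \<sigma> z)\<bar>"
    using z u it by (auto simp: eigenpair_def mem_I psi_def abs_mult Z_def sgn_if)
  also have "\<dots> \<le> tensor_map m N A (s i) t (block_repeat d \<sigma> x)"
    unfolding tensor_map_eq
  proof (rule order_trans[OF sum_abs], rule sum_mono)
    fix j assume j: "j \<in> rows (i, t)"
    have "(\<Prod>l\<in>others (i, t). \<bar>z (block l) (j l)\<bar>) \<le> (\<Prod>l\<in>others (i, t). x (block l) (j l))"
      using node[OF u j] dominated by (intro prod_mono) auto
    then show "\<bar>A j * (\<Prod>l\<in>others (i, t). z (block l) (j l))\<bar> \<le> A j * (\<Prod>l\<in>others (i, t). x (block l) (j l))"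
      using coeff_nonneg[OF u j] by (simp add: abs_mult abs_prod mult_left_mono)
  qed
  also have "\<dots> = x i t powr (p i - 1) * posy (i, t) (\<lambda>v. w v + M)"
    unfolding x_def by (simp only: tensor_map_point[OF u] point_powr[OF u])
  also have "posy (i, t) (\<lambda>v. w v + M) = \<mu>" using w[OF u] posy_cong[OF u, of "\<lambda>v. w v + M" w M] by simp
  finally have "x i t powr (p i - 1) * \<bar>lam\<bar> \<le> x i t powr (p i - 1) * \<mu>"
    by (simp add: attained mult.commute)
  moreover have "0 < x i t powr (p i - 1)" using attained it by (auto simp: Z_def)
  ultimately show ?thesis by simp
qed

theorem perron_frobenius:
  obtains w where
    "\<And>u. u \<in> I \<Longrightarrow> posy u w = tensor_spectral_radius m N d \<sigma> p A"
    "0 < tensor_spectral_radius m N d \<sigma> p A"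
    "(THE x. positive_eigenvector m N d \<sigma> p A x) = point w"
proof -
  obtain w \<mu> where all: "\<forall>u\<in>I. posy u w = \<mu>"
    and eigen: "eigenpair m N d \<sigma> p A \<mu> (point w)" and pos: "0 < \<mu>"
    using normalized_equalizer_exists by (elim exE conjE)
  note w = all[rule_format] eigen pos
  have "tensor_spectral_radius m N d \<sigma> p A = \<mu>"
    unfolding tensor_spectral_radius_def
  proof (rule cSup_eq_maximum)
    show "\<mu> \<in> {\<bar>lam\<bar> |lam. eigenvalue m N d \<sigma> p A lam}"
      using w(2,3) by (auto simp: eigenvalue_def intro!: exI[of _ \<mu>])
  qed (use eigenvalue_bound[OF w(1)] in \<open>auto simp: eigenvalue_def\<close>)
  moreover have "(THE x. positive_eigenvector m N d \<sigma> p A x) = point w"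
    using w(2) point_pos positive_eigenvector_unique[OF w(1,2)]
    by (intro the_equality) (auto simp: positive_eigenvector_def)
  ultimately show ?thesis using that[of w] w by simp
qed

section \<open>The two minimization problems\<close>

lemma sublevel_iff:
  assumes w: "\<And>u. u \<in> I \<Longrightarrow> posy u w = \<mu>"
  shows "(\<forall>u\<in>I. posy u w' \<le> \<mu>) \<longleftrightarrow> (\<exists>r. \<forall>v\<in>I. w' v = w v + r)"
proof
  assume "\<exists>r. \<forall>v\<in>I. w' v = w v + r"
  then obtain r where "\<And>v. v \<in> I \<Longrightarrow> w' v = w v + r" by blast
  then have "posy u w' = posy u w" if "u \<in> I" for u using that by (intro posy_cong)
  then show "\<forall>u\<in>I. posy u w' \<le> \<mu>" using w by simp
qed (intro sublevel_shift[OF w], auto)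

text \<open>
  A vector with all values strictly below \<open>\<mu>\<close> would be a shift of \<open>w\<close> by rigidity, and a shift has the
  same values as \<open>w\<close>.
\<close>

lemma equalizer_minimal:
  assumes w: "\<And>u. u \<in> I \<Longrightarrow> posy u w = \<mu>" and le: "\<And>u. u \<in> I \<Longrightarrow> posy u w' \<le> c"
  shows "\<mu> \<le> c"
proof (rule ccontr)
  assume c: "\<not> \<mu> \<le> c"
  have "\<forall>u\<in>I. posy u w' \<le> \<mu>" using c order_trans[OF le, of _ \<mu>] by simp
  then obtain r where r: "\<And>v. v \<in> I \<Longrightarrow> w' v = w v + r" using sublevel_iff[OF w] by blast
  obtain u where u: "u \<in> I" using I_nonempty by blast
  have "posy u w' = \<mu>" using posy_cong[OF u r] w[OF u] by simp
  then show False using le[OF u] c by simp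
qed

text \<open>
  Shifting the logarithmic coordinates by \<open>r\<close> is the scaling with \<open>t = exp r\<close>.
\<close>

lemma otimes_point:
  "otimes N d \<sigma> (\<lambda>i. exp r powr (1 / p i)) (point w) = point (\<lambda>v. w v + r)"
  unfolding otimes_def point_def
  by (rule block_vec_cong) (simp add: block_vec_apply powr_def add_divide_distrib flip: exp_add)

text \<open>
  An optimal \<open>x\<close> is one with all values at most \<open>\<mu>\<close>, so the solutions are the points whose coordinates
  are shifts of \<open>w\<close>.
\<close>

lemma phi_max_solution_set:
  assumes all: "\<forall>u\<in>I. posy u w = \<mu>"
  shows "solution_set (phi_max m N d \<sigma> p A) (block_space_pos N d \<sigma>) =
      {otimes N d \<sigma> (\<lambda>i. t powr (1 / p i)) (point w) | t. 0 < t}"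
    and "phi_max m N d \<sigma> p A (point w) = \<mu>"
    and "(INF x\<in>block_space_pos N d \<sigma>. phi_max m N d \<sigma> p A x) = \<mu>"
proof -
  note w = bspec[OF all]
  let ?f = "phi_max m N d \<sigma> p A" and ?X = "block_space_pos N d \<sigma>"
  have low: "\<mu> \<le> ?f x" if "x \<in> ?X" for x
  proof -
    have "\<forall>u\<in>I. posy u (coords x) \<le> ?f x"
      using phi_max_point_le[of "coords x" "?f x"] point_coords[OF that] by simp
    then show ?thesis using equalizer_minimal[OF w] by blast
  qed
  have "?f (point w) \<le> \<mu>" using w by (simp add: phi_max_point_le)
  then show f_w: "?f (point w) = \<mu>" using low[OF point_pos] by (rule antisym)
  show "(INF x\<in>?X. ?f x) = \<mu>"
    using f_w point_pos low by (intro cInf_eq_minimum) (auto intro: rev_image_eqI)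
  have sol: "x \<in> solution_set ?f ?X \<longleftrightarrow> x \<in> ?X \<and> ?f x \<le> \<mu>" for x
  proof -
    have "x \<in> solution_set ?f ?X \<longleftrightarrow> x \<in> ?X \<and> (\<forall>z\<in>?X. ?f x \<le> ?f z)"
      by (auto simp: solution_set_def is_arg_min_linorder)
    also have "\<dots> \<longleftrightarrow> x \<in> ?X \<and> ?f x \<le> \<mu>"
    proof safe
      assume "\<forall>z\<in>?X. ?f x \<le> ?f z"
      then have "?f x \<le> ?f (point w)" using point_pos by (rule bspec)
      then show "?f x \<le> \<mu>" unfolding f_w .
    next
      fix z assume "?f x \<le> \<mu>" "z \<in> ?X"
      then show "?f x \<le> ?f z" using low[of z] by simp
    qed
    finally show ?thesis .
  qed
  have exp_form: "(\<exists>t>0. x = otimes N d \<sigma> (\<lambda>i. t powr (1 / p i)) (point w)) \<longleftrightarrow>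
      (\<exists>r. x = point (\<lambda>v. w v + r))" for x
  proof
    assume "\<exists>t>0. x = otimes N d \<sigma> (\<lambda>i. t powr (1 / p i)) (point w)"
    then obtain t where t: "0 < t" "x = otimes N d \<sigma> (\<lambda>i. t powr (1 / p i)) (point w)" by blast
    have "x = point (\<lambda>v. w v + ln t)" using otimes_point[of "ln t" w] t by simp
    then show "\<exists>r. x = point (\<lambda>v. w v + r)" ..
  next
    assume "\<exists>r. x = point (\<lambda>v. w v + r)"
    then obtain r where "x = point (\<lambda>v. w v + r)" ..
    then show "\<exists>t>0. x = otimes N d \<sigma> (\<lambda>i. t powr (1 / p i)) (point w)"
      by (intro exI[of _ "exp r"]) (simp only: otimes_point exp_gt_zero simp_thms)
  qed
  have "x \<in> ?X \<and> ?f x \<le> \<mu> \<longleftrightarrow> (\<exists>r. x = point (\<lambda>v. w v + r))" for x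
  proof
    assume x: "x \<in> ?X \<and> ?f x \<le> \<mu>"
    then have pc: "point (coords x) = x" using point_coords by blast
    have "\<forall>u\<in>I. posy u (coords x) \<le> \<mu>" using x phi_max_point_le[of "coords x" \<mu>] unfolding pc by blast
    then obtain r where "\<forall>v\<in>I. coords x v = w v + r" using sublevel_iff[OF w] by blast
    then have "point (coords x) = point (\<lambda>v. w v + r)" by (intro point_cong) simp
    then show "\<exists>r. x = point (\<lambda>v. w v + r)" unfolding pc ..
  next
    assume "\<exists>r. x = point (\<lambda>v. w v + r)"
    then obtain r where x: "x = point (\<lambda>v. w v + r)" ..
    have "\<forall>u\<in>I. posy u (\<lambda>v. w v + r) \<le> \<mu>" using sublevel_iff[OF w, of "\<lambda>v. w v + r"] by blast
    then show "x \<in> ?X \<and> ?f x \<le> \<mu>" unfolding x by (simp add: point_pos phi_max_point_le)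
  qed
  then show "solution_set ?f ?X = {otimes N d \<sigma> (\<lambda>i. t powr (1 / p i)) (point w) | t. 0 < t}"
    using sol exp_form by (intro set_eqI) (simp only: mem_Collect_eq, blast)
qed

text \<open>
  The substitution \<open>x = exp y\<close> gives the logarithmic coordinates \<open>p\<^sub>i y\<^bsub>i,t\<^esub>\<close>. Taking logarithms is
  harmless because every value is positive.
\<close>

lemma feasible_iff:
  "(y, c) \<in> feasible m N d \<sigma> p A \<longleftrightarrow>
     y \<in> block_space N d \<sigma> \<and> (\<forall>u\<in>I. posy u (\<lambda>(i, t). p i * y i t) \<le> exp c)"
proof -
  let ?w = "\<lambda>(i, t). p i * y i t"
  have "block_vec N d \<sigma> (\<lambda>i t. exp (y i t)) = point ?w"
    unfolding point_def
  proof (rule block_vec_cong)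
    fix i t assume "(i, t) \<in> I"
    then have "p i \<noteq> 0" using p_pos[of i] by (simp add: mem_I)
    then show "exp (y i t) = exp (?w (i, t) / p i)" by simp
  qed
  then have "F_log m N d \<sigma> p A y i t - c \<le> 0 \<longleftrightarrow> posy (i, t) ?w \<le> exp c" if "(i, t) \<in> I" for i t
    using posy_pos[OF that, of ?w] ln_le_cancel_iff[of "posy (i, t) ?w" "exp c"]
    by (simp add: F_log_def block_vec_apply[OF that] Phi_point[OF that])
  then show ?thesis unfolding feasible_def by (simp add: block_indices_def)
qed

text \<open>
  A pair is optimal exactly if it is feasible at the level \<open>ln \<mu>\<close>, and feasibility at this level means
  that \<open>p\<^sub>i y\<^bsub>i,t\<^esub>\<close> is a shift of \<open>w\<close>; a shift by \<open>-\<beta>\<close> subtracts \<open>\<beta> / p\<^sub>i\<close> from \<open>y\<^bsub>i,t\<^esub>\<close>.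
\<close>

lemma feasible_solution_set:
  assumes all: "\<forall>u\<in>I. posy u w = \<mu>" and "0 < \<mu>"
    and y: "ybar = block_vec N d \<sigma> (\<lambda>i t. ln (point w i t))"
  shows "solution_set snd (feasible m N d \<sigma> p A) =
      {(block_vec N d \<sigma> (\<lambda>i t. ybar i t -
          \<beta> * otimes N d \<sigma> (\<lambda>i. inverse (p i)) (block_vec N d \<sigma> (\<lambda>_ _. 1)) i t), ln \<mu>)
       | \<beta>. True}"
proof -
  note w = bspec[OF all]
  let ?Y = "feasible m N d \<sigma> p A"
  define ray where "ray r = block_vec N d \<sigma> (\<lambda>i t. (w (i, t) + r) / p i)" for r
  have ray_eq: "block_vec N d \<sigma> (\<lambda>i t. ybar i t -
          \<beta> * otimes N d \<sigma> (\<lambda>i. inverse (p i)) (block_vec N d \<sigma> (\<lambda>_ _. 1)) i t) = ray (-\<beta>)" for \<beta>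
    unfolding ray_def y otimes_def
    by (rule block_vec_cong) (simp add: block_vec_apply point_apply divide_inverse left_diff_distrib)
  have optimal_level: "(z, ln \<mu>) \<in> ?Y \<longleftrightarrow> (\<exists>r. z = ray r)" for z
  proof
    assume "(z, ln \<mu>) \<in> ?Y"
    then have z: "z \<in> block_space N d \<sigma>" "\<forall>u\<in>I. posy u (\<lambda>(i, t). p i * z i t) \<le> \<mu>"
      using \<open>0 < \<mu>\<close> by (simp_all add: feasible_iff)
    then obtain r where r: "\<forall>v\<in>I. (\<lambda>(i, t). p i * z i t) v = w v + r"
      using sublevel_iff[OF w] by blast
    have "block_vec N d \<sigma> z = ray r"
      unfolding ray_def
    proof (rule block_vec_cong)
      fix i t assume it: "(i, t) \<in> I"
      then have "p i * z i t = w (i, t) + r" "0 < p i" using bspec[OF r it] p_pos[of i] by (auto simp: mem_I)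
      then show "z i t = (w (i, t) + r) / p i" by (simp add: field_simps)
    qed
    then show "\<exists>r. z = ray r" using block_space_eq_block_vec[OF z(1)] by auto
  next
    assume "\<exists>r. z = ray r"
    then obtain r where z: "z = ray r" ..
    have "\<forall>v\<in>I. (\<lambda>(i, t). p i * z i t) v = w v + r"
    proof safe
      fix i t assume it: "(i, t) \<in> I"
      then have "p i \<noteq> 0" using p_pos[of i] by (simp add: mem_I)
      then show "p i * z i t = w (i, t) + r" by (simp add: z ray_def block_vec_apply[OF it])
    qed
    then have "\<forall>u\<in>I. posy u (\<lambda>(i, t). p i * z i t) \<le> \<mu>" using sublevel_iff[OF w] by blast
    moreover have "z \<in> block_space N d \<sigma>" unfolding z ray_def by (rule block_vec_in_space)
    ultimately show "(z, ln \<mu>) \<in> ?Y" using \<open>0 < \<mu>\<close> by (simp add: feasible_iff)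
  qed
  have low: "ln \<mu> \<le> c" if "(z, c) \<in> ?Y" for z c
  proof -
    have "\<mu> \<le> exp c" using that equalizer_minimal[OF w] unfolding feasible_iff by blast
    then have "ln \<mu> \<le> ln (exp c)" using \<open>0 < \<mu>\<close> by (subst ln_le_cancel_iff) auto
    then show ?thesis by simp
  qed
  have ray0: "(ray 0, ln \<mu>) \<in> ?Y" using optimal_level by blast
  have "(z, c) \<in> solution_set snd ?Y \<longleftrightarrow> c = ln \<mu> \<and> (\<exists>r. z = ray r)" for z c
  proof -
    have "(z, c) \<in> solution_set snd ?Y \<longleftrightarrow> (z, c) \<in> ?Y \<and> (\<forall>q\<in>?Y. c \<le> snd q)"
      by (auto simp: solution_set_def is_arg_min_linorder)
    also have "\<dots> \<longleftrightarrow> (z, c) \<in> ?Y \<and> c = ln \<mu>"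
    proof safe
      assume "(z, c) \<in> ?Y" "\<forall>q\<in>?Y. c \<le> snd q"
      then show "c = ln \<mu>" using low[of z c] bspec[OF _ ray0, of "\<lambda>q. c \<le> snd q"] by simp
    next
      fix z' c' assume "(z', c') \<in> ?Y"
      then show "ln \<mu> \<le> snd (z', c')" using low[of z' c'] by simp
    qed
    also have "\<dots> \<longleftrightarrow> c = ln \<mu> \<and> (\<exists>r. z = ray r)" using optimal_level by blast
    finally show ?thesis .
  qed
  then have "solution_set snd ?Y = {(ray r, ln \<mu>) | r. True}" by auto
  also have "\<dots> = {(ray (-\<beta>), ln \<mu>) | \<beta>. True}" by (metis minus_minus)
  finally show ?thesis unfolding ray_eq .
qed

end

theorem theorem3p15:
  fixes m d :: nat
    and N :: "nat \<Rightarrow> nat"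
    and \<sigma> :: "nat \<Rightarrow> nat set"
    and A :: "(nat \<Rightarrow> nat) \<Rightarrow> real"
    and p :: "nat \<Rightarrow> real"
    and xbar ybar :: "nat \<Rightarrow> nat \<Rightarrow> real"
    and r :: real
  assumes "nonneg_tensor m N A"
    and "shape_partition m N d \<sigma>"
    and "\<forall>i\<in>{1..d}. 1 < p i"
    and "weakly_irreducible m N d \<sigma> A"
    and "(\<Sum>i\<in>{1..d}. real (card (\<sigma> i)) / p i) = 1"
    and "xbar = (THE x. positive_eigenvector m N d \<sigma> p A x)"
    and "ybar = block_vec N d \<sigma> (\<lambda>i t. ln (xbar i t))"
    and "r = tensor_spectral_radius m N d \<sigma> p A"
  shows
    "(solution_set (phi_max m N d \<sigma> p A) (block_space_pos N d \<sigma>) \<noteq> {} \<and>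
      solution_set (phi_max m N d \<sigma> p A) (block_space_pos N d \<sigma>) =
        {otimes N d \<sigma> (\<lambda>i. t powr (1 / p i)) xbar | t. 0 < t} \<and>
      (INF x\<in>block_space_pos N d \<sigma>. phi_max m N d \<sigma> p A x) = phi_max m N d \<sigma> p A xbar \<and>
      phi_max m N d \<sigma> p A xbar = r) \<and>
     (solution_set snd (feasible m N d \<sigma> p A) \<noteq> {} \<and>
      solution_set snd (feasible m N d \<sigma> p A) =
        {(block_vec N d \<sigma> (\<lambda>i t. ybar i t -
            \<beta> * otimes N d \<sigma> (\<lambda>i. inverse (p i)) (block_vec N d \<sigma> (\<lambda>_ _. 1)) i t), ln r)
         | \<beta>. True})"
proof -
  interpret partitioned_tensor m d N \<sigma> A p
    by (rule partitioned_tensor.intro) fact+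
  obtain w where w: "\<And>u. u \<in> I \<Longrightarrow> posy u w = r" and r: "0 < r" and x: "xbar = point w"
    by (rule perron_frobenius[folded assms(6,8)]) (rule that)
  then have all: "\<forall>u\<in>I. posy u w = r" by blast
  note S1 = phi_max_solution_set[OF all, folded x]
  note S2 = feasible_solution_set[OF all r assms(7)[unfolded x]]
  have "solution_set (phi_max m N d \<sigma> p A) (block_space_pos N d \<sigma>) \<noteq> {}"
    unfolding S1(1) by (auto intro!: exI[of _ 1])
  moreover have "solution_set snd (feasible m N d \<sigma> p A) \<noteq> {}" unfolding S2 by auto
  ultimately show ?thesis using S1 S2 by (intro conjI) simp_all
qed

end
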